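(* Let $p\neq 3$ be a rational prime, let $b=p$ or $b=-p$, and let $c\in\mathbb{Z}$ be such that $x^3+bx+c$ is irreducible over $\mathbb{Q}$. If $c$ is either prime to $p$ or divisible by $p^2$, then the splitting field of $x^3+bx+c$ over $\mathbb{Q}$ is an unramified extension of its quadratic subfield $\mathbb{Q}(\sqrt{\delta})$, where $\delta=-4b^3-27c^2$.
   Context: Unramified means unramified at all places, finite and infinite. *)

theory Defs
  imports Complex_Main "HOL-Algebra.Algebra" "HOL-Algebra.Algebraic_Closure_Type"
begin

text \<open>All number fields are realised as subfields of the complex numbers, seen as a
  HOL-Algebra ring.\<close>

abbreviation CC :: "complex ring" where
  "CC \<equiv> ring_of_type_algebra"

definition adjoin_rat :: "complex set \<Rightarrow> complex set" where
  "adjoin_rat S = generate_field CC (\<rat> \<union> S)"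

definition splitting_field :: "rat poly \<Rightarrow> complex set" where
  "splitting_field f = adjoin_rat {z. poly (map_poly of_rat f) z = 0}"

definition number_field :: "complex set \<Rightarrow> bool" where
  "number_field K \<longleftrightarrow> subfield K CC \<and> ring.finite_dimension CC \<rat> K"

definition quadratic_field :: "complex set \<Rightarrow> bool" where
  "quadratic_field K \<longleftrightarrow> subfield K CC \<and> ring.dimension CC 2 \<rat> K"

definition ring_of_integers :: "complex set \<Rightarrow> complex ring" where
  "ring_of_integers K = CC\<lparr>carrier := {x \<in> K. algebraic_int x}\<rparr>"

text \<open>For a nonzero prime \<open>P\<close> of the integers of \<open>L\<close>, the prime of \<open>K\<close> below \<open>P\<close> is
  \<open>P \<inter> K\<close>. The ramification index is the exponent of \<open>P\<close> in the prime factorisation of the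
  extension of \<open>P \<inter> K\<close> to the integers of \<open>L\<close>; containment of ideals being divisibility, it is
  the largest \<open>e\<close> such that \<open>P ^ e\<close> contains that extension. The 0-th power in \<open>ideals_set\<close> is
  the whole ring, and for \<open>P \<noteq> {0}\<close> the exponents are bounded, so \<open>GREATEST\<close> is
  meaningful.\<close>

definition ramification_index :: "complex set \<Rightarrow> complex set \<Rightarrow> complex set \<Rightarrow> nat" where
  "ramification_index K L P =
     (GREATEST e :: nat. genideal (ring_of_integers L) (P \<inter> K)
                           \<subseteq> P [^]\<^bsub>ideals_set (ring_of_integers L)\<^esub> e)"

text \<open>Residue fields of number fields are finite, so residue extensions are separable and
  only the ramification index matters.\<close>

definition unramified_at_finite_places :: "complex set \<Rightarrow> complex set \<Rightarrow> bool" where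
  "unramified_at_finite_places K L \<longleftrightarrow>
     (\<forall>P. primeideal P (ring_of_integers L) \<longrightarrow> P \<noteq> {0} \<longrightarrow> ramification_index K L P = 1)"

text \<open>Infinite places of \<open>L\<close> are the embeddings of \<open>L\<close> into the complex numbers up to complex
  conjugation. Such a place ramifies over \<open>K\<close> iff it is complex while its restriction to
  \<open>K\<close> is real.\<close>

definition unramified_at_infinite_places :: "complex set \<Rightarrow> complex set \<Rightarrow> bool" where
  "unramified_at_infinite_places K L \<longleftrightarrow>
     (\<forall>\<sigma> \<in> ring_hom (CC\<lparr>carrier := L\<rparr>) CC. \<sigma> ` K \<subseteq> \<real> \<longrightarrow> \<sigma> ` L \<subseteq> \<real>)"

definition unramified_extension :: "complex set \<Rightarrow> complex set \<Rightarrow> bool" where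
  "unramified_extension K L \<longleftrightarrow>
     number_field K \<and> number_field L \<and> K \<subseteq> L \<and>
     unramified_at_finite_places K L \<and> unramified_at_infinite_places K L"

end

theory Submission
  imports
    Defs
    "HOL-Number_Theory.Number_Theory"
    "Jordan_Normal_Form.Char_Poly"
begin

text \<open>
  Let \<open>r1, r2, r3\<close> be the roots of the cubic, \<open>s = (r1 - r2) (r1 - r3) (r2 - r3)\<close>, so that \<open>s\<^sup>2 = \<delta>\<close>,
  \<open>K = \<rat>(s)\<close>, and let \<open>L\<close> be the splitting field.

  First, \<open>\<delta>\<close> is not a square (\<open>discriminant_not_square\<close>). The only delicate case is \<open>b = - p\<close> with \<open>c\<close> prime
  to \<open>p\<close>: if \<open>\<delta> = d\<^sup>2\<close>, then \<open>4 p\<^sup>3 = d\<^sup>2 + 27 c\<^sup>2\<close> forces \<open>p = x\<^sup>2 + 3 y\<^sup>2\<close> and, by unique factorisation of norms,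
  \<open>c = \<plusminus> 2 y (x\<^sup>2 - y\<^sup>2)\<close>, so that the cubic has the root \<open>2 y\<close> or \<open>- 2 y\<close>,
  contrary to its irreducibility. Hence \<open>K\<close> is quadratic, \<open>L = K(r1)\<close> has
  degree 3 over \<open>K\<close>, and there is an automorphism \<open>\<tau>\<close> of \<open>L\<close> over \<open>K\<close> permuting the roots cyclically.

  Finite places: for every nonzero prime \<open>P\<close> of the integers of \<open>L\<close> some integer \<open>y\<close> satisfies \<open>\<tau> y \<noteq> y\<close>
  modulo \<open>P\<close> (\<open>exists_moved_mod_prime\<close>): one of the roots \<open>r\<close> will do, unless \<open>P\<close> contains \<open>p\<close> and
  \<open>p\<^sup>2\<close> divides \<open>c\<close>, where one of the numbers \<open>r\<^sup>2 / p\<close> is an integer with this property. From such a \<open>y\<close> one builds a fixed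
  combination of traces that is multiplication by an element outside \<open>P\<close>. If all traces from the
  intersection of the conjugates of \<open>P\<close> were in \<open>P\<^sup>2\<close>, Nakayama's lemma would yield \<open>P = 0\<close>
  (\<open>trace_not_in_square\<close>). So the prime of \<open>K\<close> below \<open>P\<close> contains a trace that is not in \<open>P\<^sup>2\<close>, and
  the ramification index is 1.

  Infinite places: if \<open>s\<close> is real under an embedding, so are all three roots (\<open>roots_real\<close>).
\<close>

section \<open>Algebraic integers form a ring\<close>

text \<open>The complex numbers as a module over the integers, so that \<open>Zmod.span\<close> is the additive
  group generated by a set.\<close>

interpretation Zmod: Modules.module "\<lambda>(n::int) (z::complex). of_int n * z"
  by unfold_locales (auto simp: algebra_simps)

text \<open>Multiplication by \<open>z\<close> on a finitely generated group is given by an integer matrix, of which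
  \<open>z\<close> is an eigenvalue; the characteristic polynomial is the required monic equation.\<close>

lemma algebraic_int_of_stable_span:
  assumes fin: "finite B" and b0: "b0 \<in> B" "b0 \<noteq> 0"
    and stable: "\<And>b. b \<in> B \<Longrightarrow> z * b \<in> Zmod.span B"
  shows "algebraic_int z"
proof -
  have "\<exists>u. \<forall>b\<in>B. z * b = (\<Sum>v\<in>B. of_int (u b v) * v)"
  proof -
    have "\<forall>b\<in>B. \<exists>u. z * b = (\<Sum>v\<in>B. of_int (u v) * v)"
      using stable unfolding Zmod.span_finite[OF fin] by auto
    thus ?thesis by (rule bchoice)
  qed
  then obtain u where u: "\<And>b. b \<in> B \<Longrightarrow> z * b = (\<Sum>v\<in>B. of_int (u b v) * v)" by blast
  define n where "n = card B"
  obtain e where e: "bij_betw e {0..<n} B"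
    using ex_bij_betw_nat_finite[OF fin] unfolding n_def by blast
  define M :: "int mat" where "M = mat n n (\<lambda>(i, j). u (e i) (e j))"
  have M: "M \<in> carrier_mat n n" by (simp add: M_def)
  define M' :: "complex mat" where "M' = map_mat of_int M"
  have M': "M' \<in> carrier_mat n n" using M by (simp add: M'_def)
  define w where "w = vec n e"
  have eig: "M' *\<^sub>v w = z \<cdot>\<^sub>v w"
  proof (rule eq_vecI)
    fix i assume "i < dim_vec (z \<cdot>\<^sub>v w)"
    hence i: "i < n" by (simp add: w_def)
    hence eB: "e i \<in> B" using e by (auto simp: bij_betw_def)
    have "(M' *\<^sub>v w) $ i = (\<Sum>j = 0..<n. of_int (u (e i) (e j)) * e j)"
      using i M by (simp add: M'_def M_def w_def scalar_prod_def)
    also have "\<dots> = (\<Sum>v\<in>B. of_int (u (e i) v) * v)"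
      by (rule sum.reindex_bij_betw[OF e])
    also have "\<dots> = z * e i" using u[OF eB] by simp
    finally show "(M' *\<^sub>v w) $ i = (z \<cdot>\<^sub>v w) $ i" using i by (simp add: w_def)
  qed (use M' in \<open>simp add: w_def\<close>)
  obtain i0 where i0: "i0 < n" "e i0 = b0" using e b0 by (auto simp: bij_betw_def)
  have "w \<noteq> 0\<^sub>v n"
  proof
    assume "w = 0\<^sub>v n"
    hence "w $ i0 = 0" using i0 by simp
    thus False using i0 b0 by (simp add: w_def)
  qed
  hence "eigenvalue M' z"
    using eig M' unfolding eigenvalue_def eigenvector_def
    by (intro exI[of _ w]) (auto simp: w_def)
  hence "poly (char_poly M') z = 0"
    using eigenvalue_root_char_poly[OF M'] by simp
  hence "poly (map_poly of_int (char_poly M)) z = 0"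
    by (simp add: M'_def of_int_hom.char_poly_hom[OF M])
  moreover have "lead_coeff (char_poly M) = 1"
    using degree_monic_char_poly[OF M] by simp
  ultimately show ?thesis
    unfolding algebraic_int_altdef_ipoly by blast
qed

lemma Zmod_span_mult_closed:
  assumes "\<And>b. b \<in> B \<Longrightarrow> z * b \<in> Zmod.span B" and "w \<in> Zmod.span B"
  shows "z * w \<in> Zmod.span B"
  using assms(2)
proof (induction rule: Zmod.span_induct_alt)
  case base
  show ?case by (simp add: Zmod.span_zero)
next
  case (step c x y)
  have "of_int c * (z * x) + z * y \<in> Zmod.span B"
    using step assms(1) by (intro Zmod.span_add Zmod.span_scale) auto
  thus ?case by (simp add: algebra_simps)
qed

text \<open>The group spanned by the monomials \<open>x\<^sup>i y\<^sup>j\<close> with exponents below the degrees of monic equations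
  of \<open>x\<close> and \<open>y\<close> is stable under multiplication by both.\<close>

lemma algebraic_int_stable_lattice:
  fixes x y :: complex
  assumes "algebraic_int x" "algebraic_int y"
  obtains B where "finite B" "1 \<in> B" "\<And>b. b \<in> B \<Longrightarrow> x * b \<in> Zmod.span B"
    "\<And>b. b \<in> B \<Longrightarrow> y * b \<in> Zmod.span B"
proof -
  obtain p where p: "poly (map_poly of_int p) x = 0" "lead_coeff p = (1::int)"
    using assms(1) unfolding algebraic_int_altdef_ipoly by blast
  obtain q where q: "poly (map_poly of_int q) y = 0" "lead_coeff q = (1::int)"
    using assms(2) unfolding algebraic_int_altdef_ipoly by blast
  have pos: "0 < degree r" if "poly (map_poly of_int r) w = 0" "lead_coeff r = (1::int)"
    for r and w :: complex
  proof (rule ccontr)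
    assume "\<not> 0 < degree r"
    then obtain a where "r = [:a:]" by (metis degree_eq_zeroE gr0I)
    with that show False by (simp add: map_poly_pCons)
  qed
  have red: "w ^ degree r = (\<Sum>i<degree r. of_int (- coeff r i) * w ^ i)"
    if "poly (map_poly of_int r) w = 0" "lead_coeff r = (1::int)" for r and w :: complex
  proof -
    have "0 = (\<Sum>i\<le>degree r. of_int (coeff r i) * w ^ i)"
      using that(1) by (simp add: poly_altdef degree_map_poly coeff_map_poly)
    also have "\<dots> = (\<Sum>i<degree r. of_int (coeff r i) * w ^ i) + w ^ degree r"
      using that(2) by (simp add: lessThan_Suc_atMost[symmetric])
    finally show ?thesis by (simp add: sum_negf eq_neg_iff_add_eq_0 add.commute)
  qed
  define m n where "m = degree p" and "n = degree q"
  have mn: "m > 0" "n > 0" using pos p q by (auto simp: m_def n_def)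
  define B where "B = (\<lambda>(i, j). x ^ i * y ^ j) ` ({..<m} \<times> {..<n})"
  have inB: "x ^ i * y ^ j \<in> Zmod.span B" if "i < m" "j < n" for i j
    using that by (intro Zmod.span_base) (auto simp: B_def)
  have "1 \<in> B" using mn by (auto simp: B_def intro!: image_eqI[of _ _ "(0, 0)"])
  moreover have "finite B" by (simp add: B_def)
  moreover have "x * b \<in> Zmod.span B" if b: "b \<in> B" for b
  proof -
    obtain i j where ij: "i < m" "j < n" "b = x ^ i * y ^ j" using b by (auto simp: B_def)
    show ?thesis
    proof (cases "Suc i < m")
      case True
      thus ?thesis using inB[of "Suc i" j] ij by (simp add: mult_ac)
    next
      case False
      hence "x * b = x ^ m * y ^ j" using ij by (metis Suc_lessI mult.assoc power_Suc)
      also have "\<dots> = (\<Sum>i<m. of_int (- coeff p i) * (x ^ i * y ^ j))"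
        unfolding m_def red[OF p] by (simp add: sum_distrib_right sum_distrib_left mult_ac)
      also have "\<dots> \<in> Zmod.span B"
        using ij by (intro Zmod.span_sum Zmod.span_scale inB) auto
      finally show ?thesis .
    qed
  qed
  moreover have "y * b \<in> Zmod.span B" if b: "b \<in> B" for b
  proof -
    obtain i j where ij: "i < m" "j < n" "b = x ^ i * y ^ j" using b by (auto simp: B_def)
    show ?thesis
    proof (cases "Suc j < n")
      case True
      thus ?thesis using inB[of i "Suc j"] ij by (simp add: mult_ac)
    next
      case False
      hence "y * b = x ^ i * y ^ n" using ij by (metis Suc_lessI mult.left_commute power_Suc)
      also have "\<dots> = (\<Sum>j<n. of_int (- coeff q j) * (x ^ i * y ^ j))"
        unfolding n_def red[OF q] by (simp add: sum_distrib_right sum_distrib_left mult_ac)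
      also have "\<dots> \<in> Zmod.span B"
        using ij by (intro Zmod.span_sum Zmod.span_scale inB) auto
      finally show ?thesis .
    qed
  qed
  ultimately show ?thesis using that by blast
qed

lemma algebraic_int_add:
  fixes x y :: complex
  assumes "algebraic_int x" "algebraic_int y"
  shows "algebraic_int (x + y)"
proof -
  obtain B where B: "finite B" "1 \<in> B" "\<And>b. b \<in> B \<Longrightarrow> x * b \<in> Zmod.span B"
    "\<And>b. b \<in> B \<Longrightarrow> y * b \<in> Zmod.span B"
    using algebraic_int_stable_lattice[OF assms] by blast
  show ?thesis
    by (rule algebraic_int_of_stable_span[OF B(1,2)])
       (simp_all add: distrib_right Zmod.span_add B(3,4))
qed

lemma algebraic_int_mult:
  fixes x y :: complex
  assumes "algebraic_int x" "algebraic_int y"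
  shows "algebraic_int (x * y)"
proof -
  obtain B where B: "finite B" "1 \<in> B" "\<And>b. b \<in> B \<Longrightarrow> x * b \<in> Zmod.span B"
    "\<And>b. b \<in> B \<Longrightarrow> y * b \<in> Zmod.span B"
    using algebraic_int_stable_lattice[OF assms] by blast
  show ?thesis
    by (rule algebraic_int_of_stable_span[OF B(1,2)])
       (simp_all add: mult.assoc Zmod_span_mult_closed[OF B(3) B(4)])
qed

section \<open>The discriminant is not a square\<close>

text \<open>Thue's argument: the pigeonhole principle gives a small nonzero solution of \<open>e x \<equiv> d y\<close> modulo
  \<open>p\<close>, for which \<open>x\<^sup>2 + 3 y\<^sup>2\<close> is \<open>p\<close>, \<open>2 p\<close> or \<open>3 p\<close>.\<close>

lemma prime_eq_square_plus_three_square: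
  fixes p d e :: int
  assumes p: "Factorial_Ring.prime p" "p \<noteq> 2" "p \<noteq> 3"
    and dvd: "p dvd d\<^sup>2 + 3 * e\<^sup>2" and e: "\<not> p dvd e"
  shows "\<exists>x y. p = x\<^sup>2 + 3 * y\<^sup>2"
proof -
  have p0: "p > 1" using p(1) prime_gt_1_int by blast
  define m where "m = nat \<lfloor>sqrt (of_int p)\<rfloor>"
  have m_le: "(int m)\<^sup>2 \<le> p"
  proof -
    have "of_int (int m) \<le> sqrt (real_of_int p)" using p0 by (simp add: m_def)
    hence "(real_of_int (int m))\<^sup>2 \<le> (sqrt (real_of_int p))\<^sup>2" by (intro power_mono) auto
    hence "real_of_int ((int m)\<^sup>2) \<le> real_of_int p" using p0 by simp
    thus ?thesis by linarith
  qed
  have m_ne: "(int m)\<^sup>2 \<noteq> p"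
    using p(1) by (metis prime_power_iff numeral_eq_one_iff semiring_norm(85))
  have m_lt: "(int m)\<^sup>2 < p" using m_le m_ne by simp
  have m_gt: "p < (int m + 1)\<^sup>2"
  proof -
    have "sqrt (real_of_int p) < of_int (int m + 1)" using p0 unfolding m_def by simp
    hence "(sqrt (real_of_int p))\<^sup>2 < (real_of_int (int m + 1))\<^sup>2"
      using p0 by (intro power_strict_mono) auto
    hence "real_of_int p < real_of_int ((int m + 1)\<^sup>2)" using p0 by simp
    thus ?thesis by linarith
  qed
  define A where "A = {0..int m} \<times> {0..int m}"
  define g where "g = (\<lambda>(x, y). (e * x - d * y) mod p)"
  have "g ` A \<subseteq> {0..<p}" using p0 by (auto simp: g_def)
  hence "card (g ` A) \<le> nat p" using card_mono[of "{0..<p}"] by simp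
  also have "nat p < card A"
  proof -
    have "int (card A) = (int m + 1)\<^sup>2" by (simp add: A_def power2_eq_square card_cartesian_product)
    thus ?thesis using m_gt p0 by linarith
  qed
  finally have "\<not> inj_on g A" using pigeonhole by blast
  then obtain x1 y1 x2 y2 where xy: "(x1, y1) \<in> A" "(x2, y2) \<in> A" "(x1, y1) \<noteq> (x2, y2)"
    "g (x1, y1) = g (x2, y2)" unfolding inj_on_def by auto
  define x y where "x = x1 - x2" and "y = y1 - y2"
  have nz: "x \<noteq> 0 \<or> y \<noteq> 0" using xy(3) by (auto simp: x_def y_def)
  have xm: "\<bar>x\<bar> \<le> int m" "\<bar>y\<bar> \<le> int m" using xy(1,2) by (auto simp: x_def y_def A_def)
  have dv: "p dvd e * x - d * y"
    using xy(4) by (auto simp: g_def mod_eq_dvd_iff x_def y_def algebra_simps)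
  have "e\<^sup>2 * (x\<^sup>2 + 3 * y\<^sup>2) = (e * x - d * y) * (e * x + d * y) + (d\<^sup>2 + 3 * e\<^sup>2) * y\<^sup>2"
    by (simp add: power2_eq_square algebra_simps)
  hence "p dvd e\<^sup>2 * (x\<^sup>2 + 3 * y\<^sup>2)" using dv dvd by (metis dvd_add dvd_mult2)
  hence "p dvd x\<^sup>2 + 3 * y\<^sup>2"
    using e p(1) by (metis prime_dvd_mult_iff prime_dvd_power)
  then obtain k where k: "x\<^sup>2 + 3 * y\<^sup>2 = p * k" by blast
  have pos: "0 < x\<^sup>2 + 3 * y\<^sup>2"
    using nz by (metis add_pos_nonneg add_nonneg_pos mult_nonneg_nonneg mult_pos_pos zero_le_power2
        zero_less_power2 zero_less_numeral zero_le_numeral)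
  have k0: "k > 0" using pos k p0 by (simp add: zero_less_mult_iff)
  have sq: "x\<^sup>2 < p" "y\<^sup>2 < p"
    using xm m_lt power_mono[of "\<bar>x\<bar>" "int m" 2] power_mono[of "\<bar>y\<bar>" "int m" 2] by auto
  hence "p * k < p * 4" using k by linarith
  hence "k < 4" using p0 by simp
  then consider "k = 1" | "k = 2" | "k = 3" using k0 by linarith
  thus ?thesis
  proof cases
    case 1
    thus ?thesis using k by auto
  next
    case 2
    \<comment> \<open>The form takes no value that is twice an odd number.\<close>
    have po: "odd p" using p prime_odd_int
      by (metis linorder_neqE_linordered_idom not_less_iff_gr_or_eq p0 prime_ge_2_int order_le_less)
    have "even (x\<^sup>2 + 3 * y\<^sup>2)" using k 2 by simp
    hence "even x = even y" by auto
    hence "4 dvd x\<^sup>2 + 3 * y\<^sup>2"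
    proof (cases "even x")
      case True
      then obtain a b where "x = 2 * a" "y = 2 * b" using \<open>even x = even y\<close> by (auto elim!: evenE)
      thus ?thesis by (intro dvdI[of _ _ "a\<^sup>2 + 3 * b\<^sup>2"]) (simp add: power2_eq_square algebra_simps)
    next
      case False
      then obtain a b where "x = 2 * a + 1" "y = 2 * b + 1" using \<open>even x = even y\<close> by (auto elim!: oddE)
      thus ?thesis by (intro dvdI[of _ _ "a\<^sup>2 + a + 3 * b\<^sup>2 + 3 * b + 1"]) (simp add: power2_eq_square algebra_simps)
    qed
    hence "4 dvd p * 2" using k 2 by simp
    hence False using po by presburger
    thus ?thesis ..
  next
    case 3
    have "x\<^sup>2 = 3 * (p - y\<^sup>2)" using k 3 by simp
    hence "3 dvd x\<^sup>2" by simp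
    hence "3 dvd x" using prime_dvd_power[of "3::int" x 2] by simp
    then obtain a where "x = 3 * a" by blast
    hence "p = y\<^sup>2 + 3 * a\<^sup>2" using k 3 by (simp add: power2_eq_square)
    thus ?thesis by blast
  qed
qed

text \<open>In terms of the ring of Eisenstein integers: an element \<open>d + 3 c \<surd>-3\<close> of norm \<open>4 p\<^sup>3\<close> that is prime
  to \<open>p\<close> is, up to conjugation, a unit times \<open>2 (x + y \<surd>-3)\<^sup>3\<close>, and divisibility by 3 of both
  coefficients of \<open>\<surd>-3\<close> leaves only the units 1 and -1. Here \<open>U\<close> and \<open>V\<close> are the coefficients of
  the cube.\<close>

lemma cube_norm_form:
  fixes p c d x y :: int
  assumes p: "Factorial_Ring.prime p" "p \<noteq> 2" "p \<noteq> 3" and c: "\<not> p dvd c"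
    and pxy: "p = x\<^sup>2 + 3 * y\<^sup>2" and norm: "4 * p ^ 3 = d\<^sup>2 + 27 * c\<^sup>2"
  shows "c = 2 * y * (x\<^sup>2 - y\<^sup>2) \<or> c = - (2 * y * (x\<^sup>2 - y\<^sup>2))"
proof -
  have p0: "p > 1" using p(1) prime_gt_1_int by blast
  define U V e where "U = x ^ 3 - 9 * x * y\<^sup>2" and "V = 3 * (y * (x\<^sup>2 - y\<^sup>2))" and "e = 3 * c"
  have UV: "p ^ 3 = U\<^sup>2 + 3 * V\<^sup>2"
    unfolding pxy U_def V_def by (simp add: power2_eq_square power3_eq_cube algebra_simps)
  have norm': "4 * p ^ 3 = d\<^sup>2 + 3 * e\<^sup>2" using norm by (simp add: e_def power2_eq_square)
  have pU: "\<not> p dvd U"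
  proof
    assume "p dvd U"
    have U': "U = x * (p - 12 * y\<^sup>2)"
      by (simp add: U_def pxy power2_eq_square power3_eq_cube algebra_simps)
    have px: "\<not> p dvd x"
    proof
      assume "p dvd x"
      hence "p dvd p - x\<^sup>2" by (simp add: power2_eq_square)
      hence "p dvd 3 * y\<^sup>2" by (simp add: pxy)
      hence py: "p dvd y"
        using p primes_dvd_imp_eq[of p 3] prime_dvd_power[of p y 2] by (auto simp: prime_dvd_mult_iff)
      have "p\<^sup>2 dvd x\<^sup>2 + 3 * y\<^sup>2" using py \<open>p dvd x\<close> by (intro dvd_add dvd_mult dvd_power_same) auto
      hence "p * p dvd p * 1" by (metis pxy power2_eq_square mult.right_neutral)
      hence "p dvd 1" using p0 dvd_mult_cancel_left[of p p 1] by simp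
      thus False using p0 by simp
    qed
    hence "p dvd p - 12 * y\<^sup>2" using \<open>p dvd U\<close> U' p(1) by (metis prime_dvd_mult_iff)
    hence "p dvd 12 * y\<^sup>2" by (metis dvd_diff_right_iff dvd_refl)
    hence "p dvd 12 \<or> p dvd y" using p(1) prime_dvd_mult_iff prime_dvd_power by blast
    thus False
    proof
      assume "p dvd y"
      hence "p dvd p - 3 * y\<^sup>2" by (simp add: power2_eq_square)
      hence "p dvd x\<^sup>2" by (simp add: pxy)
      thus False using px p(1) prime_dvd_power by blast
    next
      assume "p dvd 12"
      hence "p dvd 2 * 2 * 3" by simp
      hence "p dvd 2 \<or> p dvd 3" using p(1) by (metis prime_dvd_mult_iff)
      moreover have "\<not> p dvd 2" "\<not> p dvd 3"
        using p primes_dvd_imp_eq[of p 2] primes_dvd_imp_eq[of p 3] by auto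
      ultimately show False by blast
    qed
  qed
  have pe: "\<not> p dvd e"
    using c p primes_dvd_imp_eq[of p 3] by (auto simp: e_def prime_dvd_mult_iff)
  \<comment> \<open>The integer \<open>k\<close> below is the coefficient of \<open>\<surd>-3\<close> in twice the unit; \<open>V'\<close> is \<open>V\<close> or \<open>- V\<close>.\<close>
  have eq3: "e\<^sup>2 = 4 * V\<^sup>2" if V': "V'\<^sup>2 = V\<^sup>2" "3 dvd V'" "p ^ 3 dvd e * U - d * V'" for V'
  proof -
    obtain k where k: "e * U - d * V' = p ^ 3 * k" using V' by blast
    have "(d * U + 3 * e * V')\<^sup>2 + 3 * (e * U - d * V')\<^sup>2 = (d\<^sup>2 + 3 * e\<^sup>2) * (U\<^sup>2 + 3 * V'\<^sup>2)"
      by (simp add: power2_eq_square algebra_simps)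
    also have "\<dots> = 4 * (p ^ 3)\<^sup>2" using norm' UV V'(1) by (simp add: power2_eq_square)
    finally have "3 * (e * U - d * V')\<^sup>2 \<le> 4 * (p ^ 3)\<^sup>2"
      using zero_le_power2[of "d * U + 3 * e * V'"] by linarith
    hence "(p ^ 3)\<^sup>2 * (3 * k\<^sup>2) \<le> (p ^ 3)\<^sup>2 * 4"
      unfolding k by (simp add: power_mult_distrib mult_ac)
    hence "3 * k\<^sup>2 \<le> 4" using p0 by (subst (asm) mult_le_cancel_left_pos) auto
    hence "\<bar>k\<bar> < 2" using power_mono[of 2 "\<bar>k\<bar>" 2] by force
    moreover have "3 dvd p ^ 3 * k" unfolding k[symmetric] using V'(2) by (auto simp: e_def)
    hence "3 dvd p \<or> 3 dvd k"
      using prime_dvd_mult_iff[of "3::int"] prime_dvd_power[of "3::int" p 3] by auto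
    hence "3 dvd k" using p primes_dvd_imp_eq[of "3::int" p] by auto
    ultimately have "k = 0" by presburger
    hence "e * U = d * V'" using k by simp
    hence "e\<^sup>2 * U\<^sup>2 = d\<^sup>2 * V\<^sup>2" using V'(1) by (metis power_mult_distrib)
    hence "e\<^sup>2 * (U\<^sup>2 + 3 * V\<^sup>2) = (d\<^sup>2 + 3 * e\<^sup>2) * V\<^sup>2" by (simp add: algebra_simps)
    hence "p ^ 3 * e\<^sup>2 = p ^ 3 * (4 * V\<^sup>2)" using norm' UV by (simp add: mult_ac)
    thus ?thesis using p0 by simp
  qed
  have "(e * U - d * V) * (e * U - d * (- V)) = p ^ 3 * (e\<^sup>2 - 4 * V\<^sup>2)"
  proof -
    have "(e * U - d * V) * (e * U - d * (- V)) = e\<^sup>2 * U\<^sup>2 - d\<^sup>2 * V\<^sup>2"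
      by (simp add: power2_eq_square algebra_simps)
    also have "\<dots> = e\<^sup>2 * (U\<^sup>2 + 3 * V\<^sup>2) - (d\<^sup>2 + 3 * e\<^sup>2) * V\<^sup>2" by (simp add: algebra_simps)
    finally show ?thesis unfolding UV[symmetric] norm'[symmetric] by (simp add: algebra_simps)
  qed
  hence prod: "p ^ 3 dvd (e * U - d * V) * (e * U - d * (- V))" by simp
  have "\<not> (p dvd e * U - d * V \<and> p dvd e * U - d * (- V))"
  proof
    assume "p dvd e * U - d * V \<and> p dvd e * U - d * (- V)"
    hence "p dvd (e * U - d * V) + (e * U - d * (- V))" by (intro dvd_add) auto
    hence "p dvd 2 * (e * U)" by (simp add: mult_ac)
    hence "p dvd 2 \<or> p dvd e \<or> p dvd U" using p(1) by (metis prime_dvd_mult_iff)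
    thus False using pe pU p primes_dvd_imp_eq[of p 2] by auto
  qed
  hence "p ^ 3 dvd e * U - d * V \<or> p ^ 3 dvd e * U - d * (- V)"
  proof (cases "p dvd e * U - d * V")
    case True
    hence "coprime (p ^ 3) (e * U - d * (- V))"
      using \<open>\<not> (_ \<and> _)\<close> p(1) by (simp add: prime_imp_coprime)
    thus ?thesis using prod coprime_dvd_mult_left_iff by blast
  next
    case False
    hence "coprime (p ^ 3) (e * U - d * V)" using p(1) by (simp add: prime_imp_coprime)
    thus ?thesis using prod coprime_dvd_mult_right_iff by blast
  qed
  moreover have "3 dvd V" by (simp add: V_def)
  ultimately have "e\<^sup>2 = 4 * V\<^sup>2" using eq3[of V] eq3[of "- V"] by auto
  hence "c\<^sup>2 = (2 * y * (x\<^sup>2 - y\<^sup>2))\<^sup>2" by (simp add: e_def V_def power_mult_distrib)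
  thus ?thesis by (simp add: power2_eq_iff)
qed

text \<open>If \<open>p\<^sup>2\<close> divides \<open>c\<close>, the valuation of the discriminant at \<open>p\<close> is odd for odd \<open>p\<close>, and the case
  \<open>p = 2\<close> is settled modulo 4. If \<open>p\<close> does not divide \<open>c\<close>, the discriminant is
  negative for \<open>b = p\<close>; for \<open>b = - p\<close>, were it a square, \<open>2 y\<close> or \<open>- 2 y\<close> would be a root of the cubic, where
  \<open>p = x\<^sup>2 + 3 y\<^sup>2\<close>.\<close>

theorem discriminant_not_square:
  fixes p b c d :: int
  assumes p: "Factorial_Ring.prime p" "p \<noteq> 3" and b: "b = p \<or> b = - p"
    and noroot: "\<And>t::int. t ^ 3 + b * t + c \<noteq> 0"
    and c: "coprime c p \<or> p\<^sup>2 dvd c"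
  shows "d\<^sup>2 \<noteq> - 4 * b ^ 3 - 27 * c\<^sup>2"
proof
  assume d: "d\<^sup>2 = - 4 * b ^ 3 - 27 * c\<^sup>2"
  have p0: "p > 1" using p(1) prime_gt_1_int by blast
  show False
    using c
  proof
    assume "p\<^sup>2 dvd c"
    then obtain k where k: "c = p\<^sup>2 * k" by blast
    have "p dvd b ^ 3" using b by (auto simp: power3_eq_cube)
    hence "p dvd - 4 * b ^ 3 - 27 * c\<^sup>2"
      by (intro dvd_diff dvd_mult) (auto simp: k power2_eq_square)
    hence "p dvd d\<^sup>2" by (simp only: d)
    hence "p dvd d" using p(1) prime_dvd_power by blast
    then obtain e where e: "d = p * e" by blast
    have "p * p * e\<^sup>2 = p * p * (p * (- 4 * (b div p)  - 27 * p * k\<^sup>2))"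
      using d b p0 by (auto simp: k e power2_eq_square power3_eq_cube algebra_simps)
    hence e2: "e\<^sup>2 = p * (- 4 * (b div p)  - 27 * p * k\<^sup>2)" using p0 by simp
    hence "p dvd e\<^sup>2" by simp
    hence "p dvd e" using p(1) prime_dvd_power by blast
    then obtain f where f: "e = p * f" by blast
    have "p * (p * f\<^sup>2) = p * (- 4 * (b div p)  - 27 * p * k\<^sup>2)"
      using e2 by (simp add: f power2_eq_square mult_ac)
    hence f2: "p * f\<^sup>2 = - 4 * (b div p)  - 27 * p * k\<^sup>2" using p0 by simp
    have bp: "b div p = 1 \<or> b div p = -1"
      using b nonzero_mult_div_cancel_left[of p "-1"] p0 by auto
    have "4 * (b div p) = p * (- f\<^sup>2 - 27 * k\<^sup>2)" using f2 by (simp add: algebra_simps)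
    hence "p dvd 4 * (b div p)" by simp
    hence "p dvd 2 * 2" using bp by auto
    hence "p dvd 2" using p(1) by (metis prime_dvd_mult_iff)
    hence p2: "p = 2" using p(1) primes_dvd_imp_eq[of p 2] by simp
    have "f\<^sup>2 + 27 * k\<^sup>2 = 2 \<or> f\<^sup>2 + 27 * k\<^sup>2 = -2"
      using f2 bp unfolding p2 by auto
    hence fk: "(f\<^sup>2 + 27 * k\<^sup>2) mod 4 = 2" by auto
    have "f\<^sup>2 mod 4 = 0 \<or> f\<^sup>2 mod 4 = 1" "k\<^sup>2 mod 4 = 0 \<or> k\<^sup>2 mod 4 = 1"
    proof -
      have "t\<^sup>2 mod 4 = 0 \<or> t\<^sup>2 mod 4 = 1" for t :: int
      proof (cases "even t")
        case True
        then obtain a where "t = 2 * a" by blast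
        thus ?thesis by (simp add: power2_eq_square)
      next
        case False
        then obtain a where "t = 2 * a + 1" by (auto elim: oddE)
        hence "t\<^sup>2 = 1 + 4 * (a\<^sup>2 + a)" by (simp add: power2_eq_square algebra_simps)
        thus ?thesis by (simp only: mod_mult_self2) simp
      qed
      thus "f\<^sup>2 mod 4 = 0 \<or> f\<^sup>2 mod 4 = 1" "k\<^sup>2 mod 4 = 0 \<or> k\<^sup>2 mod 4 = 1" by auto
    qed
    thus False using fk by presburger
  next
    assume cop: "coprime c p"
    have pc: "\<not> p dvd c"
    proof
      assume "p dvd c"
      hence "p dvd 1" using cop by (meson coprime_common_divisor dvd_refl)
      thus False using p0 by simp
    qed
    have bp: "b = - p"
    proof (rule ccontr)
      assume "b \<noteq> - p"
      hence "d\<^sup>2 = - (4 * p ^ 3 + 27 * c\<^sup>2)" using d b by auto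
      moreover have "4 * p ^ 3 + 27 * c\<^sup>2 > 0" using p0 by (simp add: add_pos_nonneg)
      ultimately show False using zero_le_power2[of d] by linarith
    qed
    hence norm: "4 * p ^ 3 = d\<^sup>2 + 27 * c\<^sup>2" using d by simp
    have p2: "p \<noteq> 2"
    proof
      assume p2: "p = 2"
      have "\<not> 2 \<le> \<bar>c\<bar>"
      proof
        assume "2 \<le> \<bar>c\<bar>"
        hence "2\<^sup>2 \<le> \<bar>c\<bar>\<^sup>2" by (intro power_mono) auto
        thus False using norm p2 zero_le_power2[of d] by simp
      qed
      moreover have "c \<noteq> 0" using pc by auto
      ultimately have "c\<^sup>2 = 1"
        by (metis power2_eq_1_iff abs_le_iff abs_less_iff int_one_le_iff_zero_less
            linorder_not_le one_add_one verit_la_disequality zless_imp_add1_zle zero_less_abs_iff abs_1 abs_eq_iff order_antisym)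
      hence d5: "d\<^sup>2 = 5" using norm p2 by simp
      hence "\<bar>d\<bar>\<^sup>2 = 5" by simp
      moreover have "\<bar>d\<bar> \<le> 2 \<or> 3 \<le> \<bar>d\<bar>" by linarith
      ultimately show False
        using power_mono[of "\<bar>d\<bar>" 2 2] power_mono[of 3 "\<bar>d\<bar>" 2] by auto
    qed
    have "p dvd d\<^sup>2 + 3 * (3 * c)\<^sup>2"
    proof -
      have "d\<^sup>2 + 3 * (3 * c)\<^sup>2 = p * (4 * p\<^sup>2)"
        using norm by (simp add: power2_eq_square power3_eq_cube)
      thus ?thesis by simp
    qed
    moreover have "\<not> p dvd 3 * c"
      using pc p primes_dvd_imp_eq[of p 3] by (auto simp: prime_dvd_mult_iff)
    ultimately obtain x y where xy: "p = x\<^sup>2 + 3 * y\<^sup>2"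
      using prime_eq_square_plus_three_square[OF p(1) p2 p(2)] by blast
    from cube_norm_form[OF p(1) p2 p(2) pc xy norm] show False
    proof
      assume "c = 2 * y * (x\<^sup>2 - y\<^sup>2)"
      hence "(2 * y) ^ 3 + b * (2 * y) + c = 0"
        unfolding bp xy by (simp add: power2_eq_square power3_eq_cube algebra_simps)
      thus False using noroot by blast
    next
      assume "c = - (2 * y * (x\<^sup>2 - y\<^sup>2))"
      hence "(- (2 * y)) ^ 3 + b * (- (2 * y)) + c = 0"
        unfolding bp xy by (simp add: power2_eq_square power3_eq_cube algebra_simps)
      thus False using noroot by blast
    qed
  qed
qed

section \<open>Subfields of the complex numbers\<close>

lemma CC_simps [simp]:
  "carrier CC = UNIV" "x \<oplus>\<^bsub>CC\<^esub> y = x + y" "x \<otimes>\<^bsub>CC\<^esub> y = x * y" "\<one>\<^bsub>CC\<^esub> = 1" "\<zero>\<^bsub>CC\<^esub> = 0"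
  by (simp_all add: ring_of_type_algebra_def)

interpretation CC: cring CC by (rule cring_from_type_algebra)

lemma field_CC: "Ring.field CC" by (rule field_from_type_algebra)

lemma CC_minus [simp]: "\<ominus>\<^bsub>CC\<^esub> x = - x"
  by (rule CC.minus_equality) auto

lemma CC_inv: "x \<noteq> 0 \<Longrightarrow> inv\<^bsub>CC\<^esub> x = inverse x"
  by (rule CC.comm_inv_char) auto

lemma subfield_CCI:
  assumes "1 \<in> F" "\<And>x y. x \<in> F \<Longrightarrow> y \<in> F \<Longrightarrow> x + y \<in> F" "\<And>x y. x \<in> F \<Longrightarrow> y \<in> F \<Longrightarrow> x * y \<in> F"
    "\<And>x. x \<in> F \<Longrightarrow> - x \<in> F" "\<And>x. x \<in> F \<Longrightarrow> x \<noteq> 0 \<Longrightarrow> inverse x \<in> F"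
  shows "subfield F CC"
proof (rule field.subfieldI'[OF field_CC])
  show "subring F CC"
    by (rule CC.subringI) (use assms in auto)
  show "\<And>k. k \<in> F - {\<zero>\<^bsub>CC\<^esub>} \<Longrightarrow> inv\<^bsub>CC\<^esub> k \<in> F" using assms by (auto simp: CC_inv)
qed

lemma subfield_CCD:
  assumes "subfield F CC"
  shows "1 \<in> F" "0 \<in> F" "\<And>x y. x \<in> F \<Longrightarrow> y \<in> F \<Longrightarrow> x + y \<in> F" "\<And>x y. x \<in> F \<Longrightarrow> y \<in> F \<Longrightarrow> x * y \<in> F"
    "\<And>x. x \<in> F \<Longrightarrow> - x \<in> F" "\<And>x y. x \<in> F \<Longrightarrow> y \<in> F \<Longrightarrow> x - y \<in> F"
    "\<And>x. x \<in> F \<Longrightarrow> inverse x \<in> F" "\<And>x y. x \<in> F \<Longrightarrow> y \<in> F \<Longrightarrow> x / y \<in> F"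
    "\<And>x n. x \<in> F \<Longrightarrow> x ^ n \<in> F" "of_int i \<in> F" "\<rat> \<subseteq> F" "numeral w \<in> F"
proof -
  note sr = subringE[OF subfieldE(1)[OF assms], simplified]
  show one: "1 \<in> F" and zero: "0 \<in> F" using sr by auto
  show add: "\<And>x y. x \<in> F \<Longrightarrow> y \<in> F \<Longrightarrow> x + y \<in> F" using sr(7) by blast
  show mult: "\<And>x y. x \<in> F \<Longrightarrow> y \<in> F \<Longrightarrow> x * y \<in> F" using sr(6) by blast
  show minus: "\<And>x. x \<in> F \<Longrightarrow> - x \<in> F" using sr(5) by blast
  show "\<And>x y. x \<in> F \<Longrightarrow> y \<in> F \<Longrightarrow> x - y \<in> F" using add minus by (metis uminus_add_conv_diff add.commute)
  show inv: "\<And>x. x \<in> F \<Longrightarrow> inverse x \<in> F"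
    using CC.subfield_m_inv(1)[OF assms] zero by (metis CC_inv CC_simps(5) Diff_iff inverse_zero singletonD)
  show div: "\<And>x y. x \<in> F \<Longrightarrow> y \<in> F \<Longrightarrow> x / y \<in> F" using mult inv by (simp add: divide_inverse)
  show "x ^ n \<in> F" if "x \<in> F" for x n using that by (induction n) (auto intro: one mult)
  have nat: "of_nat n \<in> F" for n by (induction n) (auto intro: zero one add)
  show int: "of_int i \<in> F" for i by (cases i rule: int_cases2) (auto intro: nat minus)
  show "numeral w \<in> F" using int[of "numeral w"] by simp
  show "\<rat> \<subseteq> F"
  proof
    fix x :: complex assume "x \<in> \<rat>"
    then obtain a b where "x = of_int a / of_int b" by (auto elim: Rats_cases')
    thus "x \<in> F" by (auto intro: div int)
  qed
qed

lemma subfield_Rats: "subfield \<rat> CC"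
  by (rule subfield_CCI) auto

section \<open>Coordinates with respect to a root of the cubic\<close>

text \<open>The value at \<open>r\<close> of the polynomial of degree at most 2 with the given coefficients, constant term
  first.\<close>

definition quad :: "complex \<Rightarrow> complex \<times> complex \<times> complex \<Rightarrow> complex" where
  "quad r k = (case k of (k0, k1, k2) \<Rightarrow> k0 + k1 * r + k2 * r\<^sup>2)"

text \<open>The three complex roots of \<open>x\<^sup>3 + b x + c\<close>, a cubic without rational root. Their order fixes the
  square root \<open>s\<close> of the discriminant, assumed irrational.\<close>

locale cubic_roots =
  fixes b c :: int and r1 r2 r3 s :: complex
  assumes e1: "r1 + r2 + r3 = 0"
    and e2: "r1 * r2 + r1 * r3 + r2 * r3 = of_int b"
    and e3: "r1 * r2 * r3 = - of_int c"
    and s_def: "s = (r1 - r2) * (r1 - r3) * (r2 - r3)"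
    and no_rat_root: "\<And>t. t \<in> \<rat> \<Longrightarrow> t ^ 3 + of_int b * t + of_int c \<noteq> (0 :: complex)"
    and s_irrat: "s \<notin> \<rat>"
begin

lemma r3_eq: "r3 = - r1 - r2" using e1 by (simp add: eq_neg_iff_add_eq_0 algebra_simps)

lemma b_eq: "of_int b = - r1\<^sup>2 - r1 * r2 - r2\<^sup>2"
  unfolding e2[symmetric] r3_eq by (simp add: power2_eq_square algebra_simps)

lemma c_eq: "of_int c = r1 * r2 * (r1 + r2)"
  using e3 unfolding r3_eq by (simp add: algebra_simps)

lemma root1: "r1 ^ 3 = - of_int b * r1 - of_int c"
  unfolding b_eq c_eq by (simp add: power2_eq_square power3_eq_cube algebra_simps)

lemma s_sq: "s\<^sup>2 = - 4 * of_int b ^ 3 - 27 * (of_int c)\<^sup>2"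
  unfolding s_def b_eq c_eq r3_eq by (simp add: power2_eq_square power3_eq_cube algebra_simps)

lemma s_nz: "s \<noteq> 0" using s_irrat by auto

text \<open>A cyclic permutation of the roots preserves \<open>s\<close>, so every fact on \<open>r1\<close> also holds for \<open>r2\<close> and \<open>r3\<close>.\<close>

lemma rotate: "cubic_roots b c r2 r3 r1 s"
proof
  show "s = (r2 - r3) * (r2 - r1) * (r3 - r1)" unfolding s_def by (simp add: algebra_simps)
qed (use e1 e2 e3 no_rat_root s_irrat in \<open>auto simp: algebra_simps\<close>)

lemma quad_indep_Rats:
  assumes k: "x \<in> \<rat>" "y \<in> \<rat>" "z \<in> \<rat>" and eq: "x + y * r1 + z * r1\<^sup>2 = 0"
  shows "x = 0" "y = 0" "z = 0"
proof -
  have irr: "r1 \<notin> \<rat>" using no_rat_root[of r1] root1 by auto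
  have lin: "u = 0 \<and> v = 0" if "u \<in> \<rat>" "v \<in> \<rat>" "u + v * r1 = 0" for u v
  proof -
    have "v = 0"
    proof (rule ccontr)
      assume "v \<noteq> 0"
      hence "r1 = - u / v" using that(3) by (simp add: field_simps eq_neg_iff_add_eq_0)
      thus False using irr that by auto
    qed
    thus ?thesis using that(3) by simp
  qed
  have z: "z = 0"
  proof (rule ccontr)
    assume z: "z \<noteq> 0"
    define \<alpha> \<beta> where "\<alpha> = x / z" and "\<beta> = y / z"
    have ab: "\<alpha> \<in> \<rat>" "\<beta> \<in> \<rat>" using k by (auto simp: \<alpha>_def \<beta>_def)
    have r2: "r1\<^sup>2 = - \<alpha> - \<beta> * r1"
      using eq z by (simp add: \<alpha>_def \<beta>_def field_simps) (metis add.assoc add.commute eq_neg_iff_add_eq_0 minus_add_distrib)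
    have "r1 ^ 3 = r1 * r1\<^sup>2" by (simp add: power2_eq_square power3_eq_cube)
    also have "\<dots> = r1 * (- \<alpha> - \<beta> * r1)" by (simp only: r2)
    also have "\<dots> = - \<alpha> * r1 - \<beta> * r1\<^sup>2" by (simp add: power2_eq_square algebra_simps)
    also have "\<dots> = \<alpha> * \<beta> + (\<beta>\<^sup>2 - \<alpha>) * r1"
      unfolding r2 by (simp add: power2_eq_square algebra_simps)
    finally have "(\<alpha> * \<beta> + of_int c) + (\<beta>\<^sup>2 - \<alpha> + of_int b) * r1 = 0"
      unfolding root1 by (simp add: algebra_simps)
    hence "\<alpha> * \<beta> + of_int c = 0" "\<beta>\<^sup>2 - \<alpha> + of_int b = 0"
      using lin[of "\<alpha> * \<beta> + of_int c" "\<beta>\<^sup>2 - \<alpha> + of_int b"] ab by auto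
    moreover have "\<beta> ^ 3 + of_int b * \<beta> + of_int c =
        \<beta> * (\<beta>\<^sup>2 - \<alpha> + of_int b) + (\<alpha> * \<beta> + of_int c)"
      by (simp add: power2_eq_square power3_eq_cube algebra_simps)
    ultimately have "\<beta> ^ 3 + of_int b * \<beta> + of_int c = 0" by simp
    thus False using no_rat_root ab by blast
  qed
  show "z = 0" by (rule z)
  show "x = 0" "y = 0" using lin[of x y] k eq z by auto
qed

text \<open>Multiplication of coefficient triples modulo the cubic.\<close>

definition qmult :: "complex \<times> complex \<times> complex \<Rightarrow> complex \<times> complex \<times> complex \<Rightarrow> complex \<times> complex \<times> complex" where
  "qmult k l = (case (k, l) of ((k0, k1, k2), (l0, l1, l2)) \<Rightarrow>
     (k0 * l0 - of_int c * (k1 * l2 + k2 * l1),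
      k0 * l1 + k1 * l0 - of_int b * (k1 * l2 + k2 * l1) - of_int c * (k2 * l2),
      k0 * l2 + k1 * l1 + k2 * l0 - of_int b * (k2 * l2)))"

lemma quad_qmult: "quad r1 (qmult k l) = quad r1 k * quad r1 l"
proof -
  obtain k0 k1 k2 l0 l1 l2 where kl: "k = (k0, k1, k2)" "l = (l0, l1, l2)" by (metis prod_cases3)
  show ?thesis unfolding kl quad_def qmult_def prod.case b_eq c_eq
    by (simp add: power2_eq_square algebra_simps)
qed

text \<open>Comparing coefficients in \<open>(x + y r1 + z r1\<^sup>2)\<^sup>2 = s\<^sup>2\<close> makes \<open>y / z\<close> a rational root of the cubic when
  \<open>z\<close> is nonzero.\<close>

lemma s_notin_quad_Rats:
  assumes k: "x \<in> \<rat>" "y \<in> \<rat>" "z \<in> \<rat>"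
  shows "s \<noteq> x + y * r1 + z * r1\<^sup>2"
proof
  assume eq: "s = x + y * r1 + z * r1\<^sup>2"
  define d :: complex where "d = - 4 * of_int b ^ 3 - 27 * (of_int c)\<^sup>2"
  have "d \<in> \<rat>" by (simp add: d_def)
  have "(x\<^sup>2 - 2 * y * z * of_int c - d) + (2 * x * y - 2 * y * z * of_int b - z\<^sup>2 * of_int c) * r1
      + (y\<^sup>2 + 2 * x * z - z\<^sup>2 * of_int b) * r1\<^sup>2 = 0"
  proof -
    have "quad r1 (qmult (x, y, z) (x, y, z)) = d"
      unfolding quad_qmult using s_sq eq by (simp add: d_def quad_def power2_eq_square)
    thus ?thesis by (simp add: quad_def qmult_def power2_eq_square algebra_simps)
  qed
  hence *: "2 * x * y - 2 * y * z * of_int b - z\<^sup>2 * of_int c = 0" "y\<^sup>2 + 2 * x * z - z\<^sup>2 * of_int b = 0"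
    using quad_indep_Rats(2,3)[of "x\<^sup>2 - 2 * y * z * of_int c - d"
      "2 * x * y - 2 * y * z * of_int b - z\<^sup>2 * of_int c" "y\<^sup>2 + 2 * x * z - z\<^sup>2 * of_int b"] k \<open>d \<in> \<rat>\<close> by auto
  show False
  proof (cases "z = 0")
    case True
    thus False using * eq s_irrat k by auto
  next
    case False
    define \<beta> where "\<beta> = y / z"
    have "\<beta> \<in> \<rat>" using k by (simp add: \<beta>_def)
    have y: "y = \<beta> * z" using False by (simp add: \<beta>_def)
    have "z\<^sup>2 * (\<beta> ^ 3 + of_int b * \<beta> + of_int c) =
        \<beta> * (y\<^sup>2 + 2 * x * z - z\<^sup>2 * of_int b)
        - (2 * x * y - 2 * y * z * of_int b - z\<^sup>2 * of_int c)"
      unfolding y by (simp add: power2_eq_square power3_eq_cube algebra_simps)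
    hence "z\<^sup>2 * (\<beta> ^ 3 + of_int b * \<beta> + of_int c) = 0" by (simp only: *) simp
    thus False using False no_rat_root[OF \<open>\<beta> \<in> \<rat>\<close>] by simp
  qed
qed

text \<open>The triple whose value at \<open>r1\<close> is the product of the values of \<open>k\<close> at the two other roots.\<close>

definition qadj :: "complex \<times> complex \<times> complex \<Rightarrow> complex \<times> complex \<times> complex" where
  "qadj k = (case k of (k0, k1, k2) \<Rightarrow>
     (k0\<^sup>2 - 2 * of_int b * k0 * k2 + of_int b * k1\<^sup>2 + of_int c * k1 * k2 + (of_int b)\<^sup>2 * k2\<^sup>2,
      - k0 * k1 - of_int c * k2\<^sup>2,
      - k0 * k2 + k1\<^sup>2 + of_int b * k2\<^sup>2))"

text \<open>The product of the values at the three roots, as a polynomial in the coefficients.\<close>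

definition qnorm :: "complex \<times> complex \<times> complex \<Rightarrow> complex" where
  "qnorm k = (case k of (k0, k1, k2) \<Rightarrow>
     k0 ^ 3 - 2 * of_int b * k0\<^sup>2 * k2 + of_int b * k0 * k1\<^sup>2 + 3 * of_int c * k0 * k1 * k2
     + (of_int b)\<^sup>2 * k0 * k2\<^sup>2 - of_int c * k1 ^ 3 - of_int b * of_int c * k1 * k2\<^sup>2 + (of_int c)\<^sup>2 * k2 ^ 3)"

lemma quad_qadj: "quad r1 (qadj k) = quad r2 k * quad r3 k"
proof -
  obtain k0 k1 k2 where k: "k = (k0, k1, k2)" by (metis prod_cases3)
  show ?thesis unfolding k quad_def qadj_def prod.case b_eq c_eq r3_eq
    by (simp add: power2_eq_square power3_eq_cube algebra_simps)
qed

lemma qnorm: "qnorm k = quad r1 k * quad r2 k * quad r3 k"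
proof -
  obtain k0 k1 k2 where k: "k = (k0, k1, k2)" by (metis prod_cases3)
  show ?thesis unfolding k quad_def qnorm_def prod.case b_eq c_eq r3_eq
    by (simp add: power2_eq_square power3_eq_cube algebra_simps)
qed

text \<open>Inverses come from dividing the product of the two other conjugates by the norm.\<close>

lemma subfield_quad:
  assumes F: "subfield F CC"
    and indep: "\<And>k. k \<in> F \<times> F \<times> F \<Longrightarrow> k \<noteq> (0, 0, 0) \<Longrightarrow> quad r2 k \<noteq> 0 \<and> quad r3 k \<noteq> 0"
  shows "subfield (quad r1 ` (F \<times> F \<times> F)) CC"
proof (rule subfield_CCI)
  note F = subfield_CCD[OF F]
  show "1 \<in> quad r1 ` (F \<times> F \<times> F)"
    by (rule image_eqI[of _ _ "(1, 0, 0)"]) (auto simp: quad_def F)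
  fix x assume "x \<in> quad r1 ` (F \<times> F \<times> F)"
  then obtain k where k: "k \<in> F \<times> F \<times> F" "x = quad r1 k" by blast
  obtain k0 k1 k2 where kk: "k = (k0, k1, k2)" by (metis prod_cases3)
  show "- x \<in> quad r1 ` (F \<times> F \<times> F)"
    by (rule image_eqI[of _ _ "(- k0, - k1, - k2)"]) (use k in \<open>auto simp: quad_def kk F\<close>)
  {
    fix y assume "y \<in> quad r1 ` (F \<times> F \<times> F)"
    then obtain l where l: "l \<in> F \<times> F \<times> F" "y = quad r1 l" by blast
    obtain l0 l1 l2 where ll: "l = (l0, l1, l2)" by (metis prod_cases3)
    show "x + y \<in> quad r1 ` (F \<times> F \<times> F)"
      by (rule image_eqI[of _ _ "(k0 + l0, k1 + l1, k2 + l2)"])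
         (use k l in \<open>auto simp: quad_def kk ll F algebra_simps\<close>)
    show "x * y \<in> quad r1 ` (F \<times> F \<times> F)"
      by (rule image_eqI[of _ _ "qmult k l"])
         (simp add: quad_qmult k l, use k l in \<open>auto simp: qmult_def kk ll F\<close>)
  }
  assume x: "x \<noteq> 0"
  hence "k \<noteq> (0, 0, 0)" using k by (auto simp: quad_def)
  hence nz: "quad r2 k \<noteq> 0" "quad r3 k \<noteq> 0" using indep k by auto
  have N: "qnorm k \<in> F" using k by (auto simp: qnorm_def kk F)
  have "x * quad r1 (qadj k) = qnorm k" using k by (simp add: quad_qadj qnorm mult_ac)
  hence "inverse x = quad r1 (qadj k) / qnorm k" using x nz k
    by (simp add: quad_qadj qnorm field_simps)
  also have "\<dots> = quad r1 (qmult (inverse (qnorm k), 0, 0) (qadj k))"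
    unfolding quad_qmult by (simp add: quad_def[of _ "(_, 0, 0)"] field_simps)
  finally show "inverse x \<in> quad r1 ` (F \<times> F \<times> F)"
  proof (rule image_eqI)
    show "qmult (inverse (qnorm k), 0, 0) (qadj k) \<in> F \<times> F \<times> F"
      using k N by (auto simp: qmult_def qadj_def kk F)
  qed
qed

section \<open>The quadratic field and the splitting field\<close>

text \<open>The field generated by \<open>s\<close> over the rational numbers.\<close>

definition K :: "complex set" where "K = {x + y * s | x y. x \<in> \<rat> \<and> y \<in> \<rat>}"

lemma KI: "x \<in> \<rat> \<Longrightarrow> y \<in> \<rat> \<Longrightarrow> x + y * s \<in> K" unfolding K_def by blast

lemma s_sq_rat: "s\<^sup>2 \<in> \<rat>" by (simp add: s_sq)

lemma K_indep: "x \<in> \<rat> \<Longrightarrow> y \<in> \<rat> \<Longrightarrow> x + y * s = 0 \<Longrightarrow> x = 0 \<and> y = 0"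
proof -
  assume xy: "x \<in> \<rat>" "y \<in> \<rat>" "x + y * s = 0"
  have "y = 0"
  proof (rule ccontr)
    assume "y \<noteq> 0"
    hence "s = - x / y" using xy(3) by (simp add: field_simps eq_neg_iff_add_eq_0)
    thus False using s_irrat xy by auto
  qed
  thus ?thesis using xy by simp
qed

lemma subfield_K: "subfield K CC"
proof (rule subfield_CCI)
  show "1 \<in> K" using KI[of 1 0] by simp
  fix z assume "z \<in> K"
  then obtain x y where z: "z = x + y * s" "x \<in> \<rat>" "y \<in> \<rat>" by (auto simp: K_def)
  show "- z \<in> K" using KI[of "- x" "- y"] z by simp
  {
    fix z' assume "z' \<in> K"
    then obtain x' y' where z': "z' = x' + y' * s" "x' \<in> \<rat>" "y' \<in> \<rat>" by (auto simp: K_def)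
    show "z + z' \<in> K" using KI[of "x + x'" "y + y'"] z z' by (simp add: algebra_simps)
    show "z * z' \<in> K"
    proof -
      have "z * z' = (x * x' + y * y' * s\<^sup>2) + (x * y' + x' * y) * s"
        by (simp add: z z' algebra_simps power2_eq_square)
      thus ?thesis using z z' s_sq_rat by (simp add: KI)
    qed
  }
  assume nz: "z \<noteq> 0"
  have n: "x - y * s \<noteq> 0" using K_indep[of x "- y"] z nz by auto
  have m: "z * (x - y * s) = x\<^sup>2 - y\<^sup>2 * s\<^sup>2" using z by (simp add: power2_eq_square algebra_simps)
  have "z * ((x - y * s) / (x\<^sup>2 - y\<^sup>2 * s\<^sup>2)) = 1" using n nz by (simp flip: m)
  hence "inverse z = (x - y * s) / (x\<^sup>2 - y\<^sup>2 * s\<^sup>2)" by (rule inverse_unique)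
  also have "\<dots> = x / (x\<^sup>2 - y\<^sup>2 * s\<^sup>2) + (- y / (x\<^sup>2 - y\<^sup>2 * s\<^sup>2)) * s" by (simp add: diff_divide_distrib)
  also have "\<dots> \<in> K" using z s_sq_rat by (intro KI) auto
  finally show "inverse z \<in> K" .
qed

lemma s_in_K: "s \<in> K" using KI[of 0 1] by simp

lemma quad_Rats_nz:
  assumes "k \<in> \<rat> \<times> \<rat> \<times> \<rat>" "k \<noteq> (0, 0, 0)" shows "quad r1 k \<noteq> 0"
proof
  obtain x y z where k: "k = (x, y, z)" by (metis prod_cases3)
  assume "quad r1 k = 0"
  hence "x + y * r1 + z * r1\<^sup>2 = 0" by (simp add: k quad_def)
  moreover have "x \<in> \<rat>" "y \<in> \<rat>" "z \<in> \<rat>" using assms(1) by (simp_all add: k)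
  ultimately have "k = (0, 0, 0)" using quad_indep_Rats[of x y z] by (simp add: k)
  thus False using assms(2) by simp
qed

lemma subfield_quad_Rats: "subfield (quad r1 ` (\<rat> \<times> \<rat> \<times> \<rat>)) CC"
proof -
  interpret rot: cubic_roots b c r2 r3 r1 s by (rule rotate)
  interpret rot2: cubic_roots b c r3 r1 r2 s by (rule rot.rotate)
  show ?thesis
    by (intro subfield_quad subfield_Rats conjI rot.quad_Rats_nz rot2.quad_Rats_nz)
qed

text \<open>The cubic remains irreducible over \<open>K\<close>: writing the coefficients in the basis \<open>1, s\<close>, a relation would
  express \<open>s\<close> in the cubic field.\<close>

lemma quad_K_nz:
  assumes k: "k \<in> K \<times> K \<times> K" "k \<noteq> (0, 0, 0)" shows "quad r1 k \<noteq> 0"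
proof
  assume 0: "quad r1 k = 0"
  obtain x0 y0 x1 y1 x2 y2 where k': "k = (x0 + y0 * s, x1 + y1 * s, x2 + y2 * s)"
    and rat: "x0 \<in> \<rat>" "y0 \<in> \<rat>" "x1 \<in> \<rat>" "y1 \<in> \<rat>" "x2 \<in> \<rat>" "y2 \<in> \<rat>"
    using k(1) by (auto simp: K_def)
  define A B where "A = quad r1 (x0, x1, x2)" and "B = quad r1 (y0, y1, y2)"
  have AB: "A + B * s = 0" using 0 by (simp add: A_def B_def k' quad_def algebra_simps)
  have *: "A \<in> quad r1 ` (\<rat> \<times> \<rat> \<times> \<rat>)" "B \<in> quad r1 ` (\<rat> \<times> \<rat> \<times> \<rat>)"
    using rat by (auto simp: A_def B_def)
  have "B = 0"
  proof (rule ccontr)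
    assume "B \<noteq> 0"
    hence "s = - A / B" using AB by (simp add: field_simps eq_neg_iff_add_eq_0)
    also have "\<dots> \<in> quad r1 ` (\<rat> \<times> \<rat> \<times> \<rat>)"
      using * by (intro subfield_CCD[OF subfield_quad_Rats])
    finally show False using s_notin_quad_Rats by (auto simp: quad_def)
  qed
  hence "A = 0" using AB by simp
  have "(x0, x1, x2) = (0, 0, 0)" using \<open>A = 0\<close> quad_Rats_nz rat unfolding A_def by blast
  moreover have "(y0, y1, y2) = (0, 0, 0)" using \<open>B = 0\<close> quad_Rats_nz rat unfolding B_def by blast
  ultimately show False using k k' by auto
qed

text \<open>The field generated by \<open>r1\<close> over \<open>K\<close>; it contains the other roots, hence is the splitting field.\<close>

definition L :: "complex set" where "L = quad r1 ` (K \<times> K \<times> K)"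

lemma subfield_L: "subfield L CC"
proof -
  interpret rot: cubic_roots b c r2 r3 r1 s by (rule rotate)
  interpret rot2: cubic_roots b c r3 r1 r2 s by (rule rot.rotate)
  show ?thesis unfolding L_def
    by (intro subfield_quad subfield_K conjI rot.quad_K_nz rot2.quad_K_nz)
qed

lemma quad_inj: "inj_on (quad r1) (K \<times> K \<times> K)"
proof (rule inj_onI)
  fix k l assume kl: "k \<in> K \<times> K \<times> K" "l \<in> K \<times> K \<times> K" "quad r1 k = quad r1 l"
  obtain k0 k1 k2 l0 l1 l2 where e: "k = (k0, k1, k2)" "l = (l0, l1, l2)" by (metis prod_cases3)
  note F = subfield_CCD[OF subfield_K]
  have "quad r1 (k0 - l0, k1 - l1, k2 - l2) = 0" using kl by (simp add: e quad_def algebra_simps)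
  moreover have "(k0 - l0, k1 - l1, k2 - l2) \<in> K \<times> K \<times> K" using kl by (auto simp: e intro: F(6))
  ultimately have "(k0 - l0, k1 - l1, k2 - l2) = (0, 0, 0)" using quad_K_nz by blast
  thus "k = l" by (simp add: e)
qed

text \<open>The difference of the other two roots is \<open>s\<close> divided by the derivative \<open>3 r1\<^sup>2 + b\<close> of the cubic at
  \<open>r1\<close>, whose inverse modulo the cubic is explicit.\<close>

lemma r2_eq: "r2 = quad r1 (- 2 * (of_int b)\<^sup>2 / s, (9 * of_int c / s - 1) / 2, - 3 * of_int b / s)"
proof -
  have "s * (2 * r2 + r1) = - (6 * of_int b * r1\<^sup>2 - 9 * of_int c * r1 + 4 * (of_int b)\<^sup>2)"
    unfolding s_def b_eq c_eq r3_eq by (simp add: power2_eq_square algebra_simps)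
  hence "r2 = (- (6 * of_int b * r1\<^sup>2 - 9 * of_int c * r1 + 4 * (of_int b)\<^sup>2) / s - r1) / 2"
    using s_nz by (simp add: field_simps)
  also have "\<dots> = quad r1 (- 2 * (of_int b)\<^sup>2 / s, (9 * of_int c / s - 1) / 2, - 3 * of_int b / s)"
    using s_nz by (simp add: quad_def field_simps)
  finally show ?thesis .
qed

lemma coeffs_in_K: "- 2 * (of_int b)\<^sup>2 / s \<in> K" "(9 * of_int c / s - 1) / 2 \<in> K" "- 3 * of_int b / s \<in> K"
  by (auto intro!: subfield_CCD[OF subfield_K] s_in_K)

lemma K_subset_L: "K \<subseteq> L"
proof
  fix k assume "k \<in> K"
  thus "k \<in> L" unfolding L_def
    by (intro image_eqI[of _ _ "(k, 0, 0)"]) (auto simp: quad_def subfield_CCD[OF subfield_K])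
qed

lemma roots_in_L: "r1 \<in> L" "r2 \<in> L" "r3 \<in> L"
proof -
  note F = subfield_CCD[OF subfield_L]
  show r1: "r1 \<in> L" unfolding L_def
    by (intro image_eqI[of _ _ "(0, 1, 0)"]) (auto simp: quad_def subfield_CCD[OF subfield_K])
  show r2: "r2 \<in> L" unfolding L_def
    by (subst r2_eq, intro imageI SigmaI coeffs_in_K)
  show "r3 \<in> L" unfolding r3_eq by (intro F(5,6) r1 r2)
qed

section \<open>The automorphism permuting the roots cyclically\<close>

text \<open>The automorphism of \<open>L\<close> over \<open>K\<close> that sends \<open>r1\<close> to \<open>r2\<close>. Outside \<open>L\<close> its value is irrelevant.\<close>

definition \<tau> :: "complex \<Rightarrow> complex" where
  "\<tau> x = quad r2 (inv_into (K \<times> K \<times> K) (quad r1) x)"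

lemma \<tau>_quad: "k \<in> K \<times> K \<times> K \<Longrightarrow> \<tau> (quad r1 k) = quad r2 k"
  unfolding \<tau>_def by (subst inv_into_f_f[OF quad_inj]) auto

lemma L_cases:
  assumes "x \<in> L" obtains k where "k \<in> K \<times> K \<times> K" "x = quad r1 k" "\<tau> x = quad r2 k"
proof -
  from assms obtain k where k: "k \<in> K \<times> K \<times> K" "x = quad r1 k" unfolding L_def by blast
  show thesis using that[OF k] \<tau>_quad[OF k(1)] k(2) by simp
qed

lemma \<tau>_K: "k \<in> K \<Longrightarrow> \<tau> k = k"
  using \<tau>_quad[of "(k, 0, 0)"] by (auto simp: quad_def subfield_CCD[OF subfield_K])

lemma \<tau>_add: assumes "x \<in> L" "y \<in> L" shows "\<tau> (x + y) = \<tau> x + \<tau> y"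
proof -
  from assms(1) obtain k where k: "k \<in> K \<times> K \<times> K" "x = quad r1 k" "\<tau> x = quad r2 k" by (rule L_cases)
  from assms(2) obtain l where l: "l \<in> K \<times> K \<times> K" "y = quad r1 l" "\<tau> y = quad r2 l" by (rule L_cases)
  obtain k0 k1 k2 l0 l1 l2 where e: "k = (k0, k1, k2)" "l = (l0, l1, l2)" by (metis prod_cases3)
  have "\<tau> (quad r1 (k0 + l0, k1 + l1, k2 + l2)) = quad r2 (k0 + l0, k1 + l1, k2 + l2)"
    using k l by (intro \<tau>_quad) (auto simp: e intro: subfield_CCD(3)[OF subfield_K])
  thus ?thesis using k l by (simp add: e quad_def algebra_simps)
qed

lemma \<tau>_mult: assumes "x \<in> L" "y \<in> L" shows "\<tau> (x * y) = \<tau> x * \<tau> y"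
proof -
  interpret rot: cubic_roots b c r2 r3 r1 s by (rule rotate)
  from assms(1) obtain k where k: "k \<in> K \<times> K \<times> K" "x = quad r1 k" "\<tau> x = quad r2 k" by (rule L_cases)
  from assms(2) obtain l where l: "l \<in> K \<times> K \<times> K" "y = quad r1 l" "\<tau> y = quad r2 l" by (rule L_cases)
  have "qmult k l \<in> K \<times> K \<times> K" using k(1) l(1) by (auto simp: qmult_def subfield_CCD[OF subfield_K])
  hence "\<tau> (quad r1 (qmult k l)) = quad r2 (qmult k l)" by (rule \<tau>_quad)
  thus ?thesis using k l rot.quad_qmult[of k l] by (simp add: quad_qmult)
qed

lemma \<tau>_roots: "\<tau> r1 = r2" "\<tau> r2 = r3" "\<tau> r3 = r1"
proof -
  interpret rot: cubic_roots b c r2 r3 r1 s by (rule rotate)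
  show 1: "\<tau> r1 = r2" using \<tau>_quad[of "(0, 1, 0)"] by (auto simp: quad_def subfield_CCD[OF subfield_K])
  show 2: "\<tau> r2 = r3"
    by (subst r2_eq, subst \<tau>_quad) (use coeffs_in_K rot.r2_eq in auto)
  note F = subfield_CCD[OF subfield_L]
  have m1: "-1 \<in> K" by (intro subfield_CCD[OF subfield_K])
  have neg: "\<tau> (- x) = - \<tau> x" if "x \<in> L" for x
    using \<tau>_mult[of "- 1" x] \<tau>_K[OF m1] m1 K_subset_L that by auto
  have "\<tau> r3 = \<tau> (- r1 + - r2)" by (simp add: r3_eq)
  also have "\<dots> = - r2 - r3"
    using \<tau>_add[of "- r1" "- r2"] roots_in_L by (simp add: neg 1 2 F(5))
  also have "\<dots> = r1" by (simp add: r3_eq)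
  finally show "\<tau> r3 = r1" .
qed

lemma \<tau>_in_L: "x \<in> L \<Longrightarrow> \<tau> x \<in> L"
proof -
  assume "x \<in> L"
  then obtain k where k: "k \<in> K \<times> K \<times> K" "\<tau> x = quad r2 k" by (rule L_cases)
  thus ?thesis using K_subset_L roots_in_L by (auto simp: quad_def intro!: subfield_CCD[OF subfield_L])
qed

lemma \<tau>_\<tau>: assumes "x \<in> L" "x = quad r1 k" "k \<in> K \<times> K \<times> K"
  shows "\<tau> (\<tau> x) = quad r3 k" "\<tau> (\<tau> (\<tau> x)) = x"
proof -
  obtain k0 k1 k2 where e: "k = (k0, k1, k2)" by (metis prod_cases3)
  note F = subfield_CCD[OF subfield_L]
  have kL: "k0 \<in> L" "k1 \<in> L" "k2 \<in> L" and kK: "k0 \<in> K" "k1 \<in> K" "k2 \<in> K"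
    using assms(3) K_subset_L by (auto simp: e)
  have *: "\<tau> (quad r k) = quad (\<tau> r) k" if "r \<in> L" for r
    using that kL kK by (simp add: e quad_def power2_eq_square \<tau>_add \<tau>_mult \<tau>_K F)
  show "\<tau> (\<tau> x) = quad r3 k" "\<tau> (\<tau> (\<tau> x)) = x"
    using roots_in_L by (simp_all add: assms(2) * \<tau>_roots)
qed

lemma \<tau>_order: "x \<in> L \<Longrightarrow> \<tau> (\<tau> (\<tau> x)) = x"
  using \<tau>_\<tau> by (metis L_cases)

lemma trace_in_K: assumes "x \<in> L" shows "x + \<tau> x + \<tau> (\<tau> x) \<in> K"
proof -
  from assms obtain k where k: "k \<in> K \<times> K \<times> K" "x = quad r1 k" "\<tau> x = quad r2 k" by (rule L_cases)
  obtain k0 k1 k2 where e: "k = (k0, k1, k2)" by (metis prod_cases3)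
  have "x + \<tau> x + \<tau> (\<tau> x) = quad r1 k + quad r2 k + quad r3 k"
    using \<tau>_\<tau>(1)[OF assms k(2,1)] k by simp
  also have "\<dots> = 3 * k0 - 2 * of_int b * k2"
    unfolding e quad_def b_eq r3_eq by (simp add: power2_eq_square algebra_simps)
  also have "\<dots> \<in> K" using k(1) by (auto simp: e intro!: subfield_CCD[OF subfield_K])
  finally show ?thesis .
qed

lemma \<tau>_poly:
  assumes "x \<in> L" shows "\<tau> (poly (map_poly of_int p) x) = poly (map_poly of_int p) (\<tau> x)"
proof -
  note F = subfield_CCD[OF subfield_L]
  have "poly (map_poly of_int p) x \<in> L \<and> \<tau> (poly (map_poly of_int p) x) = poly (map_poly of_int p) (\<tau> x)"
  proof (induction p)
    case 0
    show ?case using \<tau>_K[OF subfield_CCD(2)[OF subfield_K]] by (simp add: F)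
  next
    case (pCons a p)
    show ?case using pCons assms by (auto simp: map_poly_pCons F \<tau>_add \<tau>_mult \<tau>_K subfield_CCD(10)[OF subfield_K])
  qed
  thus ?thesis ..
qed

lemma \<tau>_algebraic_int: assumes "x \<in> L" "algebraic_int x" shows "algebraic_int (\<tau> x)"
proof -
  obtain p where p: "poly (map_poly of_int p) x = 0" "lead_coeff p = (1::int)"
    using assms(2) unfolding algebraic_int_altdef_ipoly by blast
  have "poly (map_poly of_int p) (\<tau> x) = 0"
    using \<tau>_poly[OF assms(1), of p] p(1) \<tau>_K[OF subfield_CCD(2)[OF subfield_K]] by simp
  thus ?thesis unfolding algebraic_int_altdef_ipoly using p(2) by blast
qed

end

section \<open>Primes with trivial inertia are unramified\<close>

interpretation Qvs: Vector_Spaces.vector_space "\<lambda>(q::rat) (z::complex). of_rat q * z"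
  by unfold_locales (auto simp: algebra_simps of_rat_add of_rat_mult)

text \<open>The linear combinations of the list \<open>gs\<close> with coefficients from \<open>C\<close>.\<close>

fun lin :: "complex set \<Rightarrow> complex list \<Rightarrow> complex set" where
  "lin C [] = {0}"
| "lin C (g # gs) = {a * g + w | a w. a \<in> C \<and> w \<in> lin C gs}"

lemma lin_ConsI: "a \<in> C \<Longrightarrow> w \<in> lin C gs \<Longrightarrow> a * g + w \<in> lin C (g # gs)"
  by auto

lemma lin_add:
  assumes "\<And>a a'. a \<in> C \<Longrightarrow> a' \<in> C \<Longrightarrow> a + a' \<in> C"
  shows "x \<in> lin C gs \<Longrightarrow> y \<in> lin C gs \<Longrightarrow> x + y \<in> lin C gs"
proof (induction gs arbitrary: x y)
  case (Cons g gs)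
  obtain a w where x: "x = a * g + w" "a \<in> C" "w \<in> lin C gs" using Cons.prems(1) by auto
  obtain a' w' where y: "y = a' * g + w'" "a' \<in> C" "w' \<in> lin C gs" using Cons.prems(2) by auto
  have "x + y = (a + a') * g + (w + w')" by (simp add: x y algebra_simps)
  also have "\<dots> \<in> lin C (g # gs)" using x y assms Cons.IH by (intro lin_ConsI) auto
  finally show ?case .
qed auto

lemma lin_scale:
  assumes "\<And>a. a \<in> C \<Longrightarrow> d * a \<in> C'"
  shows "x \<in> lin C gs \<Longrightarrow> d * x \<in> lin C' gs"
proof (induction gs arbitrary: x)
  case (Cons g gs)
  obtain a w where x: "x = a * g + w" "a \<in> C" "w \<in> lin C gs" using Cons.prems by auto
  have "d * x = (d * a) * g + d * w" by (simp add: x algebra_simps)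
  also have "\<dots> \<in> lin C' (g # gs)" using x assms Cons.IH by (intro lin_ConsI) auto
  finally show ?case .
qed auto

lemma sum_in_lin:
  assumes "\<And>v. v \<in> set gs \<Longrightarrow> f v \<in> C" "distinct gs"
  shows "(\<Sum>v\<in>set gs. f v * v) \<in> lin C gs"
  using assms
proof (induction gs)
  case (Cons g gs)
  thus ?case by (simp only: list.set sum.insert[OF finite_set] distinct.simps not_False_eq_True)
      (auto simp del: lin.simps intro!: lin_ConsI)
qed auto

text \<open>A prime ideal \<open>P\<close> of a ring \<open>A\<close> of algebraic integers, both as sets of complex numbers.\<close>

locale prime_in_order =
  fixes A P :: "complex set"
  assumes A_one: "1 \<in> A"
    and A_add: "x \<in> A \<Longrightarrow> y \<in> A \<Longrightarrow> x + y \<in> A"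
    and A_mult: "x \<in> A \<Longrightarrow> y \<in> A \<Longrightarrow> x * y \<in> A"
    and A_minus: "x \<in> A \<Longrightarrow> - x \<in> A"
    and A_int: "x \<in> A \<Longrightarrow> algebraic_int x"
    and P_sub: "P \<subseteq> A"
    and P_zero: "0 \<in> P"
    and P_add: "x \<in> P \<Longrightarrow> y \<in> P \<Longrightarrow> x + y \<in> P"
    and P_mult: "a \<in> A \<Longrightarrow> x \<in> P \<Longrightarrow> a * x \<in> P"
    and P_one: "1 \<notin> P"
    and P_prime: "x \<in> A \<Longrightarrow> y \<in> A \<Longrightarrow> x * y \<in> P \<Longrightarrow> x \<in> P \<or> y \<in> P"
begin

lemma A_zero: "0 \<in> A" using P_zero P_sub by blast

lemma A_diff: "x \<in> A \<Longrightarrow> y \<in> A \<Longrightarrow> x - y \<in> A"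
  using A_add[of x "- y"] A_minus by simp

lemma A_of_int: "of_int n \<in> A"
proof -
  have nat: "of_nat n \<in> A" for n by (induction n) (auto intro: A_zero A_one A_add)
  show ?thesis by (cases n rule: int_cases2) (auto intro: nat A_minus)
qed

lemma P_minus: "x \<in> P \<Longrightarrow> - x \<in> P"
  using P_mult[of "- 1" x] A_minus A_one by simp

lemma P_diff: "x \<in> P \<Longrightarrow> y \<in> P \<Longrightarrow> x - y \<in> P"
  using P_add[of x "- y"] P_minus by simp

text \<open>The square of the ideal \<open>P\<close>.\<close>

definition PP :: "complex set" where "PP = ideal_prod (CC\<lparr>carrier := A\<rparr>) P P"

lemma PP_prod: "x \<in> P \<Longrightarrow> y \<in> P \<Longrightarrow> x * y \<in> PP"
  using ideal_prod.prod[of x P y P "CC\<lparr>carrier := A\<rparr>"] by (simp add: PP_def)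

lemma PP_add: "x \<in> PP \<Longrightarrow> y \<in> PP \<Longrightarrow> x + y \<in> PP"
  using ideal_prod.sum[of x "CC\<lparr>carrier := A\<rparr>" P P y] by (simp add: PP_def)

lemma PP_induct [consumes 1, case_names prod sum]:
  assumes "x \<in> PP" "\<And>i j. i \<in> P \<Longrightarrow> j \<in> P \<Longrightarrow> Q (i * j)" "\<And>x y. Q x \<Longrightarrow> Q y \<Longrightarrow> Q (x + y)"
  shows "Q x"
  using assms(1) unfolding PP_def
  by (induction rule: ideal_prod.induct) (use assms(2,3) in auto)

lemma PP_scale: "x \<in> PP \<Longrightarrow> a \<in> A \<Longrightarrow> a * x \<in> PP"
proof (induction rule: PP_induct)
  case (prod i j)
  thus ?case using PP_prod[of "a * i" j] P_mult by (simp add: mult.assoc)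
next
  case (sum x y)
  thus ?case by (simp add: distrib_left PP_add)
qed

lemma PP_diff: "x \<in> PP \<Longrightarrow> y \<in> PP \<Longrightarrow> x - y \<in> PP"
  using PP_add[of x "- y"] PP_scale[of y "- 1"] A_minus A_one by simp

text \<open>Nakayama's lemma for the localisation at \<open>P\<close>, without forming it: the elements \<open>u\<close> and \<open>v\<close> outside
  \<open>P\<close> play the role of common denominators. The square of \<open>P\<close> contains \<open>v P\<close>, so one generator at a
  time can be eliminated.\<close>

lemma local_nakayama:
  assumes "u \<in> A - P" "\<And>x. x \<in> P \<Longrightarrow> u * x \<in> lin A gs" "set gs \<subseteq> P"
    and v: "v \<in> A - P" "\<And>x. x \<in> P \<Longrightarrow> v * x \<in> PP"
  shows "P \<subseteq> {0}"
  using assms(1-3)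
proof (induction gs arbitrary: u)
  case Nil
  thus ?case using P_zero by auto
next
  case (Cons g gs)
  have PP_lin: "u * x \<in> lin P (g # gs)" if "x \<in> PP" for x
    using that
  proof (induction rule: PP_induct)
    case (prod i j)
    have "i * (u * j) \<in> lin P (g # gs)"
      by (rule lin_scale[OF _ Cons.prems(2)[OF prod(2)]]) (use P_mult[OF _ prod(1)] in \<open>simp add: mult.commute\<close>)
    thus ?case by (simp add: mult_ac)
  next
    case (sum x y)
    thus ?case using lin_add[of P, OF P_add] by (simp add: distrib_left del: lin.simps)
  qed
  have "u * (v * g) \<in> lin P (g # gs)" using PP_lin v Cons.prems(3) by auto
  then obtain a w where aw: "u * (v * g) = a * g + w" "a \<in> P" "w \<in> lin P gs" by auto
  define u' where "u' = u * v - a"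
  have uv: "u * v \<in> A - P" using Cons.prems(1) v P_prime[of u v] A_mult by blast
  have u': "u' \<in> A - P"
  proof -
    have "u' \<in> A" using uv aw P_sub A_diff unfolding u'_def by blast
    moreover have "u' \<notin> P" using P_add[of u' a] aw(2) uv by (auto simp: u'_def)
    ultimately show ?thesis by blast
  qed
  have g: "u' * g = w" using aw by (simp add: u'_def algebra_simps)
  show ?case
  proof (rule Cons.IH)
    show "u' * u \<in> A - P" using u' Cons.prems(1) P_prime[of u' u] A_mult by blast
    show "set gs \<subseteq> P" using Cons.prems(3) by simp
    fix x assume "x \<in> P"
    then obtain a' w' where x: "u * x = a' * g + w'" "a' \<in> A" "w' \<in> lin A gs"
      using Cons.prems(2)[of x] by auto
    have "u' * u * x = a' * w + u' * w'" unfolding g[symmetric] by (simp add: x(1) mult.assoc) (simp add: algebra_simps)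
    also have "\<dots> \<in> lin A gs"
    proof (rule lin_add[OF A_add])
      show "a' * w \<in> lin A gs" using aw(3) x(2) P_sub A_mult lin_scale[of P a' A] by blast
      show "u' * w' \<in> lin A gs" using x(3) u' A_mult lin_scale[of A u' A] by blast
    qed
    finally show "u' * u * x \<in> lin A gs" .
  qed
qed

lemma prime_number_in_P:
  assumes "\<not> P \<subseteq> {0}"
  obtains q :: int where "Factorial_Ring.prime q" "of_int q \<in> P"
proof -
  obtain x where x: "x \<in> P" "x \<noteq> 0" using assms by auto
  have const: "\<exists>n. n \<noteq> 0 \<and> of_int n \<in> P"
    if "poly (map_poly of_int f) x = 0" "f \<noteq> (0 :: int poly)" for f
    using that
  proof (induction f)
    case (pCons a f)
    have polyA: "poly (map_poly of_int g) x \<in> A" for g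
      by (induction g) (use x P_sub in \<open>auto simp: map_poly_pCons A_zero intro!: A_add A_mult A_of_int\<close>)
    have eq: "of_int a + x * poly (map_poly of_int f) x = 0" using pCons.prems by (simp add: map_poly_pCons)
    show ?case
    proof (cases "a = 0")
      case True
      hence "f \<noteq> 0" using pCons by auto
      thus ?thesis using pCons.IH eq True x(2) by simp
    next
      case False
      have "of_int a = - (poly (map_poly of_int f) x * x)" using eq by (simp add: eq_neg_iff_add_eq_0 mult.commute)
      also have "\<dots> \<in> P" using polyA x by (intro P_minus P_mult)
      finally show ?thesis using False by blast
    qed
  qed auto
  obtain f where "poly (map_poly of_int f) x = 0" "lead_coeff f = (1::int)"
    using A_int x(1) P_sub unfolding algebraic_int_altdef_ipoly by blast
  moreover from this have "f \<noteq> 0" by auto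
  ultimately obtain n where n: "n \<noteq> 0" "of_int n \<in> P" using const[of f] by blast
  have "\<exists>q. Factorial_Ring.prime q \<and> of_int q \<in> P" if "n \<noteq> 0" "of_int n \<in> P" for n :: int
    using that
  proof (induction n rule: prime_divisors_induct)
    case (unit x)
    hence "x = 1 \<or> x = - 1" by auto
    hence "of_int (x * x) \<in> P" using P_mult[OF A_of_int unit(3), of x] by simp
    thus ?case using P_one \<open>x = 1 \<or> x = - 1\<close> by auto
  next
    case (factor q x)
    hence "of_int q \<in> P \<or> of_int x \<in> P" using P_prime[OF A_of_int A_of_int, of q x] by simp
    thus ?case using factor by auto
  qed auto
  thus ?thesis using that n by blast
qed

end

lemma common_denominator:
  fixes u :: "'a \<Rightarrow> rat"
  assumes "finite S"
  shows "\<exists>D. D \<noteq> 0 \<and> (\<forall>v\<in>S. of_int D * u v \<in> \<int>)"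
  using assms
proof (induction S)
  case empty
  show ?case by (intro exI[of _ 1]) auto
next
  case (insert x S)
  then obtain D where D: "D \<noteq> 0" "\<forall>v\<in>S. of_int D * u v \<in> \<int>" by blast
  obtain a b where ab: "u x = of_int a / of_int b" "b > 0" by (cases "u x") (auto simp: Fract_of_int_quotient)
  have "of_int (D * b) * u v \<in> \<int>" if "v \<in> insert x S" for v
  proof (cases "v = x")
    case True
    have "of_int (D * b) * u x = of_int (D * a)" using ab by simp
    thus ?thesis using True by (metis Ints_of_int)
  next
    case False
    hence "of_int D * u v \<in> \<int>" using D that by simp
    hence "of_int b * (of_int D * u v) \<in> \<int>" by (rule Ints_mult[OF Ints_of_int])
    thus ?thesis by (simp add: mult_ac)
  qed
  thus ?case using D ab by (intro exI[of _ "D * b"]) auto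
qed

text \<open>A rational relation can be scaled to an integral one with coprime coefficients.\<close>

lemma dependent_integer_relation:
  assumes S: "finite S" "Qvs.dependent S" and q: "\<not> q dvd (1::int)"
  obtains n where "(\<Sum>v\<in>S. of_int (n v) * v) = 0" "\<exists>v\<in>S. \<not> q dvd n v"
proof -
  obtain u v0 where u: "(\<Sum>v\<in>S. of_rat (u v) * v) = 0" "v0 \<in> S" "u v0 \<noteq> 0"
    using S Qvs.dependent_finite by auto
  obtain D where D: "D \<noteq> 0" "\<forall>v\<in>S. of_int D * u v \<in> \<int>" using common_denominator[OF S(1)] by blast
  define m where "m = (\<lambda>v. \<lfloor>of_int D * u v\<rfloor>)"
  have m: "of_int (m v) = of_int D * u v" if "v \<in> S" for v using D that by (auto simp: m_def)
  have mc: "of_int (m v) = of_int D * (of_rat (u v) :: complex)" if "v \<in> S" for v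
    using m[OF that] by (metis of_rat_mult of_rat_of_int_eq)
  have sum: "(\<Sum>v\<in>S. of_int (m v) * v) = (0::complex)"
  proof -
    have "(\<Sum>v\<in>S. of_int (m v) * v) = of_int D * (\<Sum>v\<in>S. of_rat (u v) * v)"
      unfolding sum_distrib_left by (intro sum.cong) (auto simp: mc)
    thus ?thesis by (simp add: u)
  qed
  define g where "g = Gcd (m ` S)"
  have "m v0 \<noteq> 0" using m[OF u(2)] u(3) D(1) by auto
  hence g0: "g \<noteq> 0" using u(2) by (auto simp: g_def)
  define n where "n = (\<lambda>v. m v div g)"
  have mn: "m v = g * n v" if "v \<in> S" for v using that by (simp add: n_def g_def)
  show ?thesis
  proof (rule that)
    have "of_int g * (\<Sum>v\<in>S. of_int (n v) * v) = (\<Sum>v\<in>S. of_int (m v) * v)"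
      unfolding sum_distrib_left by (intro sum.cong) (auto simp: mn)
    thus "(\<Sum>v\<in>S. of_int (n v) * v) = 0" using g0 sum by simp
    show "\<exists>v\<in>S. \<not> q dvd n v"
    proof (rule ccontr)
      assume "\<not> (\<exists>v\<in>S. \<not> q dvd n v)"
      hence "g * q dvd Gcd (m ` S)" by (intro Gcd_greatest) (auto simp: mn)
      hence "g * q dvd g * 1" by (simp add: g_def)
      thus False using g0 q by (subst (asm) dvd_mult_cancel_left) auto
    qed
  qed
qed

context prime_in_order
begin

text \<open>Let \<open>q\<close> be the prime number in \<open>P\<close>. Elements of \<open>A\<close> that are independent modulo \<open>q A\<close> are independent
  over the rational numbers, so there are boundedly many of them; a maximal family in \<open>P\<close> generates
  \<open>P\<close> together with \<open>q\<close>.\<close>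

lemma P_finitely_generated:
  assumes B: "finite B" "A \<subseteq> Qvs.span B" and P: "\<not> P \<subseteq> {0}"
  obtains gs where "set gs \<subseteq> P" "P \<subseteq> lin A gs"
proof -
  obtain q where q: "Factorial_Ring.prime q" "of_int q \<in> P" using prime_number_in_P[OF P] .
  define qfree where "qfree = (\<lambda>S. \<forall>n a. a \<in> A \<longrightarrow> (\<Sum>v\<in>S. of_int (n v) * v) = of_int q * a \<longrightarrow>
      (\<forall>v\<in>S. q dvd n v))"
  define good where "good = (\<lambda>S. finite S \<and> S \<subseteq> P \<and> qfree S)"
  have bound: "card S < Suc (card B)" if good: "good S" for S
  proof -
    have "Qvs.independent S"
    proof
      assume "Qvs.dependent S"
      then obtain n where n: "(\<Sum>v\<in>S. of_int (n v) * v) = 0" "\<exists>v\<in>S. \<not> q dvd n v"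
        using dependent_integer_relation[of S q] good q(1) not_prime_unit unfolding good_def by blast
      have "\<forall>v\<in>S. q dvd n v"
        using good n(1) A_zero unfolding good_def qfree_def by (metis mult_zero_right)
      thus False using n(2) by blast
    qed
    thus ?thesis using Qvs.independent_span_bound[OF B(1)] good B(2) P_sub
      unfolding good_def by (meson less_Suc_eq_le subset_trans)
  qed
  have "good {}" by (simp add: good_def qfree_def)
  then obtain S where S: "good S" "\<And>S'. good S' \<Longrightarrow> card S' \<le> card S"
    using ex_has_greatest_nat[of good "{}" card "Suc (card B)"] bound by blast
  obtain ss where ss: "set ss = S" "distinct ss" using S(1) finite_distinct_list by (auto simp: good_def)
  have "x \<in> lin A (of_int q # ss)" if x: "x \<in> P" for x
  proof (cases "x \<in> S")
    case True
    have "(\<Sum>v\<in>set ss. (if v = x then 1 else 0) * v) \<in> lin A ss"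
      using ss by (intro sum_in_lin) (auto simp: A_one A_zero)
    also have "(\<Sum>v\<in>set ss. (if v = x then 1 else 0) * v) = x"
      using True ss S(1) by (simp add: good_def if_distrib[of "\<lambda>t. t * _"] cong: if_cong)
    finally show ?thesis using lin_ConsI[of 0 A x ss "of_int q"] A_zero by simp
  next
    case False
    have fin: "finite S" using S(1) by (simp add: good_def)
    have "\<not> good (insert x S)" using S(2)[of "insert x S"] False fin by auto
    hence "\<not> qfree (insert x S)" using S(1) x by (auto simp: good_def)
    then obtain n a where na: "a \<in> A" "(\<Sum>v\<in>insert x S. of_int (n v) * v) = of_int q * a"
      "\<exists>v\<in>insert x S. \<not> q dvd n v" unfolding qfree_def by blast
    have rel: "of_int (n x) * x + (\<Sum>v\<in>S. of_int (n v) * v) = of_int q * a"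
      using na(2) fin False by simp
    have "\<not> q dvd n x"
    proof
      assume "q dvd n x"
      then obtain t where t: "n x = q * t" by blast
      have "(\<Sum>v\<in>S. of_int (n v) * v) = of_int q * (a - of_int t * x)"
        using rel by (simp add: t algebra_simps)
      moreover have "a - of_int t * x \<in> A" using na(1) x P_sub by (intro A_diff A_mult A_of_int) auto
      ultimately have "\<forall>v\<in>S. q dvd n v" using S(1) unfolding good_def qfree_def by blast
      thus False using na(3) t by auto
    qed
    hence "coprime (n x) q" using q(1) prime_imp_coprime coprime_commute by blast
    then obtain \<alpha> \<beta> where ab: "\<alpha> * n x + \<beta> * q = 1" by (metis bezout_int coprime_imp_gcd_eq_1)
    have "x = of_int (\<alpha> * n x + \<beta> * q) * x" by (simp add: ab)
    also have "\<dots> = of_int \<alpha> * (of_int (n x) * x) + of_int \<beta> * of_int q * x" by (simp add: algebra_simps)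
    also have "of_int (n x) * x = of_int q * a - (\<Sum>v\<in>S. of_int (n v) * v)" using rel by (simp add: algebra_simps)
    also have "of_int \<alpha> * (of_int q * a - (\<Sum>v\<in>S. of_int (n v) * v)) + of_int \<beta> * of_int q * x =
       (of_int \<alpha> * a + of_int \<beta> * x) * of_int q + (\<Sum>v\<in>set ss. of_int (- \<alpha> * n v) * v)"
      by (simp add: ss algebra_simps sum_negf sum_distrib_left)
    also have "\<dots> \<in> lin A (of_int q # ss)"
      using na(1) x P_sub ss by (intro lin_ConsI A_add A_mult A_of_int sum_in_lin) auto
    finally show ?thesis .
  qed
  thus ?thesis using that[of "of_int q # ss"] q(2) S(1) ss by (auto simp: good_def simp del: lin.simps)
qed

lemma not_locally_square:
  assumes "finite B" "A \<subseteq> Qvs.span B" "\<not> P \<subseteq> {0}" "v \<in> A - P"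
  shows "\<exists>x\<in>P. v * x \<notin> PP"
proof (rule ccontr)
  assume "\<not> (\<exists>x\<in>P. v * x \<notin> PP)"
  moreover obtain gs where "set gs \<subseteq> P" "P \<subseteq> lin A gs" using P_finitely_generated assms by blast
  ultimately have "P \<subseteq> {0}" using local_nakayama[of 1 gs v] A_one P_one assms(4) by auto
  thus False using assms(3) by blast
qed

text \<open>Let \<open>\<tau>\<close> be an automorphism of order 3 acting nontrivially on \<open>A\<close> modulo \<open>P\<close>. If the trace mapped the
  intersection \<open>I\<close> of the conjugates of \<open>P\<close> into the square of \<open>P\<close>, then this square would contain \<open>d z\<close>
  for all \<open>z\<close> in \<open>I\<close> and a certain \<open>d\<close> outside \<open>P\<close>: a combination of traces in which the terms with \<open>\<tau> z\<close>
  and \<open>\<tau> (\<tau> z)\<close> cancel. As some multiple \<open>u P\<close> with \<open>u\<close> outside \<open>P\<close> lies in \<open>I\<close>, this contradicts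
  Nakayama's lemma.\<close>

lemma trace_not_in_square:
  fixes \<tau> :: "complex \<Rightarrow> complex"
  assumes B: "finite B" "A \<subseteq> Qvs.span B" and P: "\<not> P \<subseteq> {0}"
    and \<tau>_A: "\<And>x. x \<in> A \<Longrightarrow> \<tau> x \<in> A"
    and \<tau>_mult: "\<And>x y. x \<in> A \<Longrightarrow> y \<in> A \<Longrightarrow> \<tau> (x * y) = \<tau> x * \<tau> y"
    and \<tau>_order: "\<And>x. x \<in> A \<Longrightarrow> \<tau> (\<tau> (\<tau> x)) = x"
    and y: "y \<in> A" "y - \<tau> y \<notin> P"
  shows "\<exists>z\<in>P. \<tau> z \<in> P \<and> \<tau> (\<tau> z) \<in> P \<and> z + \<tau> z + \<tau> (\<tau> z) \<notin> PP"
proof (rule ccontr)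
  define tr where "tr = (\<lambda>z. z + \<tau> z + \<tau> (\<tau> z))"
  define I where "I = {z \<in> P. \<tau> z \<in> P \<and> \<tau> (\<tau> z) \<in> P}"
  assume "\<not> (\<exists>z\<in>P. \<tau> z \<in> P \<and> \<tau> (\<tau> z) \<in> P \<and> z + \<tau> z + \<tau> (\<tau> z) \<notin> PP)"
  hence tr: "tr z \<in> PP" if "z \<in> I" for z using that by (auto simp: tr_def I_def)
  have PA: "x \<in> A" if "x \<in> P" for x using that P_sub by blast
  have I_mult: "a * z \<in> I" if "z \<in> I" "a \<in> A" for a z
    using that by (auto simp: I_def \<tau>_mult PA \<tau>_A intro!: P_mult)
  \<comment> \<open>Either \<open>\<tau>\<close> preserves \<open>P\<close>, or \<open>u\<close> is found in both other conjugates of \<open>P\<close>.\<close>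
  have "\<exists>u\<in>A - P. \<forall>x\<in>P. u * x \<in> I"
  proof (cases "\<forall>x\<in>P. \<tau> x \<in> P")
    case True
    thus ?thesis using A_one P_one by (intro bexI[of _ 1]) (auto simp: I_def)
  next
    case n1: False
    show ?thesis
    proof (cases "\<forall>x\<in>P. \<tau> (\<tau> x) \<in> P")
      case True
      hence "\<tau> x \<in> P" if "x \<in> P" for x
        using that \<tau>_order[of "\<tau> x"] \<tau>_A PA by metis
      thus ?thesis using n1 by blast
    next
      case False
      then obtain v where v: "v \<in> P" "\<tau> (\<tau> v) \<notin> P" by blast
      obtain w where w: "w \<in> P" "\<tau> w \<notin> P" using n1 by blast
      define u where "u = \<tau> (\<tau> v) * \<tau> w"
      have u: "u \<in> A - P" using v w P_prime[of "\<tau> (\<tau> v)" "\<tau> w"] by (auto simp: u_def PA \<tau>_A A_mult)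
      have t: "\<tau> u = v * \<tau> (\<tau> w)" "\<tau> (\<tau> u) = \<tau> v * w"
        using v w by (simp_all add: u_def \<tau>_mult PA \<tau>_A \<tau>_order)
      have tP: "\<tau> u \<in> P"
        using P_mult[of "\<tau> (\<tau> w)" v] v w by (simp add: t(1) PA \<tau>_A mult.commute)
      have ttP: "\<tau> (\<tau> u) \<in> P"
        unfolding t(2) using P_mult[of "\<tau> v" w] v w by (simp add: PA \<tau>_A)
      have "u * x \<in> I" if "x \<in> P" for x
        using that u tP ttP P_mult[of "\<tau> x" "\<tau> u"] P_mult[of "\<tau> (\<tau> x)" "\<tau> (\<tau> u)"]
        by (auto simp: I_def \<tau>_mult PA \<tau>_A mult.commute intro!: P_mult)
      thus ?thesis using u by blast
    qed
  qed
  then obtain u where u: "u \<in> A - P" "\<And>x. x \<in> P \<Longrightarrow> u * x \<in> I" by blast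
  define d where "d = (\<tau> y - y) * (y - \<tau> y)"
  have "d = - ((y - \<tau> y) * (y - \<tau> y))" by (simp add: d_def algebra_simps)
  hence d: "d \<in> A - P"
    using P_prime[of "y - \<tau> y" "y - \<tau> y"] P_minus[of d] y A_diff \<tau>_A A_mult A_minus by auto
  have dI: "d * z \<in> PP" if z: "z \<in> I" for z
  proof -
    have zA: "z \<in> A" using z PA by (auto simp: I_def)
    have "d * z = (\<tau> y * y) * tr z - \<tau> y * tr (\<tau> y * z) - y * tr (y * z) + tr ((y * \<tau> y) * z)"
      using y zA by (simp add: d_def tr_def \<tau>_mult \<tau>_A \<tau>_order A_mult) (simp add: algebra_simps)
    also have "\<dots> \<in> PP"
      using y z by (intro PP_add PP_diff PP_scale tr I_mult A_mult \<tau>_A) auto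
    finally show ?thesis .
  qed
  have "d * u \<in> A - P" using d u(1) P_prime[of d u] A_mult by blast
  then obtain x where x: "x \<in> P" "d * u * x \<notin> PP" using not_locally_square[OF B P] by blast
  thus False using dI[OF u(2)[OF x(1)]] by (simp add: mult.assoc)
qed

end

section \<open>Finite places\<close>

lemma ring_of_integers_simps [simp]:
  "carrier (ring_of_integers M) = {x \<in> M. algebraic_int x}"
  "x \<oplus>\<^bsub>ring_of_integers M\<^esub> y = x + y" "x \<otimes>\<^bsub>ring_of_integers M\<^esub> y = x * y"
  "\<one>\<^bsub>ring_of_integers M\<^esub> = 1" "\<zero>\<^bsub>ring_of_integers M\<^esub> = 0"
  by (simp_all add: ring_of_integers_def)

lemma prime_in_order_integers:
  assumes M: "subfield M CC" and P: "primeideal P (ring_of_integers M)"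
  shows "prime_in_order {x \<in> M. algebraic_int x} P"
proof -
  interpret P: primeideal P "ring_of_integers M" by (rule P)
  show ?thesis
  proof
    show "P \<subseteq> {x \<in> M. algebraic_int x}" using P.a_subset by simp
    show "0 \<in> P"
      using additive_subgroup.zero_closed[OF ideal.axioms(1)[OF primeideal.axioms(1)[OF P]]] by simp
    show "x + y \<in> P" if "x \<in> P" "y \<in> P" for x y
      using additive_subgroup.a_closed[OF ideal.axioms(1)[OF primeideal.axioms(1)[OF P]] that] by simp
    show "a * x \<in> P" if "a \<in> {x \<in> M. algebraic_int x}" "x \<in> P" for a x
      using P.I_l_closed[of x a] that by simp
    show "1 \<notin> P" using P.I_notcarr P.one_imp_carrier by auto
    show "x \<in> P \<or> y \<in> P" if "x \<in> {x \<in> M. algebraic_int x}" "y \<in> {x \<in> M. algebraic_int x}" "x * y \<in> P" for x y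
      using P.I_prime[of x y] that by simp
  qed (use subfield_CCD[OF M] in \<open>auto intro: algebraic_int_add algebraic_int_mult\<close>)
qed

lemma power_ideal_subset:
  assumes R: "ring R" and P: "ideal P R"
  shows "P [^]\<^bsub>ideals_set R\<^esub> Suc n \<subseteq> P"
    and "P [^]\<^bsub>ideals_set R\<^esub> Suc (Suc n) \<subseteq> ideal_prod R P P"
    and "P [^]\<^bsub>ideals_set R\<^esub> Suc 0 = P"
proof -
  interpret ring R by (rule R)
  have pow_Suc: "P [^]\<^bsub>ideals_set R\<^esub> Suc n = ideal_prod R (P [^]\<^bsub>ideals_set R\<^esub> n) P" for n
    by (simp add: nat_pow_def ideals_set_def)
  have pow_0: "P [^]\<^bsub>ideals_set R\<^esub> (0::nat) = carrier R"
    by (simp add: nat_pow_def ideals_set_def)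
  have ideal_pow: "ideal (P [^]\<^bsub>ideals_set R\<^esub> n) R" for n :: nat
    by (induction n) (simp_all only: pow_0 pow_Suc oneideal ideal_prod_is_ideal P)
  have sub: "P [^]\<^bsub>ideals_set R\<^esub> Suc n \<subseteq> P" for n
    unfolding pow_Suc using ideal_prod_inter[OF ideal_pow P] by blast
  show "P [^]\<^bsub>ideals_set R\<^esub> Suc n \<subseteq> P" by (rule sub)
  show "P [^]\<^bsub>ideals_set R\<^esub> Suc (Suc n) \<subseteq> ideal_prod R P P"
  proof
    fix x assume "x \<in> P [^]\<^bsub>ideals_set R\<^esub> Suc (Suc n)"
    hence "x \<in> ideal_prod R (P [^]\<^bsub>ideals_set R\<^esub> Suc n) P" by (simp only: pow_Suc)
    thus "x \<in> ideal_prod R P P"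
      by (induction rule: ideal_prod.induct) (use sub in \<open>auto intro: ideal_prod.intros\<close>)
  qed
  have "P \<subseteq> ideal_prod R (carrier R) P"
  proof
    fix x assume x: "x \<in> P"
    hence "\<one>\<^bsub>R\<^esub> \<otimes>\<^bsub>R\<^esub> x \<in> ideal_prod R (carrier R) P" by (intro ideal_prod.prod) auto
    thus "x \<in> ideal_prod R (carrier R) P" using x ideal.Icarr[OF P] by simp
  qed
  thus "P [^]\<^bsub>ideals_set R\<^esub> Suc 0 = P"
    using sub[of 0] pow_Suc[of 0] pow_0 by simp
qed

text \<open>An element of the prime below \<open>P\<close> outside the square of \<open>P\<close> excludes every exponent above 1.\<close>

lemma ramification_index_eq_1:
  assumes P: "ideal P (ring_of_integers M)"
    and z: "z \<in> P \<inter> N" "z \<notin> ideal_prod (ring_of_integers M) P P"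
  shows "ramification_index N M P = 1"
proof -
  interpret P: ideal P "ring_of_integers M" by (rule P)
  have ring: "ring (ring_of_integers M)" by (rule ideal.axioms(2)[OF P])
  note pow = power_ideal_subset[OF ring P]
  have sub: "P \<inter> N \<subseteq> carrier (ring_of_integers M)" using P.a_subset by blast
  show ?thesis
    unfolding ramification_index_def
  proof (rule Greatest_equality)
    show "genideal (ring_of_integers M) (P \<inter> N) \<subseteq> P [^]\<^bsub>ideals_set (ring_of_integers M)\<^esub> (1::nat)"
      using ring.genideal_minimal[OF ring P, of "P \<inter> N"] pow(3) by simp
    fix e :: nat
    assume e: "genideal (ring_of_integers M) (P \<inter> N) \<subseteq> P [^]\<^bsub>ideals_set (ring_of_integers M)\<^esub> e"
    show "e \<le> 1"
    proof (rule ccontr)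
      assume "\<not> e \<le> 1"
      then obtain n where n: "e = Suc (Suc n)" by (metis One_nat_def Suc_le_mono le0 not0_implies_Suc)
      have "z \<in> genideal (ring_of_integers M) (P \<inter> N)"
        using ring.genideal_self[OF ring sub] z(1) by blast
      thus False using e z(2) pow(2)[of n] unfolding n by blast
    qed
  qed
qed

context cubic_roots
begin

lemma L_finite_dim: "L \<subseteq> Qvs.span {1, s, r1, s * r1, r1\<^sup>2, s * r1\<^sup>2}"
proof
  fix x assume "x \<in> L"
  then obtain k0 k1 k2 where x: "x = k0 + k1 * r1 + k2 * r1\<^sup>2" and K: "k0 \<in> K" "k1 \<in> K" "k2 \<in> K"
    by (auto simp: L_def quad_def)
  let ?S = "Qvs.span {1, s, r1, s * r1, r1\<^sup>2, s * r1\<^sup>2}"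
  have *: "k * w \<in> ?S" if k: "k \<in> K" and w: "w \<in> ?S" "s * w \<in> ?S" for k w
  proof -
    obtain u v where "k = of_rat u + of_rat v * s" using k by (auto simp: K_def Rats_def)
    hence "k * w = of_rat u * w + of_rat v * (s * w)" by (simp add: algebra_simps)
    also have "\<dots> \<in> ?S" using w by (intro Qvs.span_add Qvs.span_scale)
    finally show ?thesis .
  qed
  have "k0 * 1 \<in> ?S" "k1 * r1 \<in> ?S" "k2 * r1\<^sup>2 \<in> ?S"
    by (rule *, simp add: K, simp add: Qvs.span_base, simp add: Qvs.span_base)+
  thus "x \<in> ?S" using Qvs.span_add by (simp add: x)
qed

lemma roots_algebraic_int: "algebraic_int r1" "algebraic_int r2" "algebraic_int r3"
proof -
  have "algebraic_int r" if "r ^ 3 = - of_int b * r - of_int c" for r :: complex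
  proof (rule algebraic_int.intros)
    show "lead_coeff [:of_int c, of_int b, 0, 1 :: complex:] = 1" by simp
    show "\<forall>i. coeff [:of_int c, of_int b, 0, 1 :: complex:] i \<in> \<int>"
      by (auto simp: coeff_pCons split: nat.splits)
    have "poly [:of_int c, of_int b, 0, 1:] r = r ^ 3 + of_int b * r + of_int c"
      by (simp add: power3_eq_cube algebra_simps)
    thus "poly [:of_int c, of_int b, 0, 1:] r = 0" using that by simp
  qed
  moreover interpret rot: cubic_roots b c r2 r3 r1 s by (rule rotate)
  interpret rot2: cubic_roots b c r3 r1 r2 s by (rule rot.rotate)
  show "algebraic_int r1" "algebraic_int r2" "algebraic_int r3"
    using calculation root1 rot.root1 rot2.root1 by auto
qed

text \<open>The integers of \<open>L\<close>.\<close>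

definition OL :: "complex set" where "OL = {x \<in> L. algebraic_int x}"

text \<open>When \<open>p\<^sup>2\<close> divides \<open>c\<close> the number \<open>y = r1\<^sup>2 / p\<close> is integral: squaring \<open>r1 (r1\<^sup>2 + b) = - c\<close> and
  dividing by \<open>p\<^sup>3\<close> yields \<open>y (y + \<epsilon>)\<^sup>2 = p k\<^sup>2\<close>.\<close>

lemma root_sq_div_integral:
  fixes p \<epsilon> k :: int
  assumes "p \<noteq> 0" "b = \<epsilon> * p" "c = p\<^sup>2 * k"
  shows "algebraic_int (r1\<^sup>2 / of_int p)"
proof (rule algebraic_int.intros)
  let ?f = "[:- of_int (p * k\<^sup>2), (of_int \<epsilon>)\<^sup>2, 2 * of_int \<epsilon>, 1 :: complex:]"
  show "lead_coeff ?f = 1" by simp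
  show "\<forall>i. coeff ?f i \<in> \<int>" by (auto simp: coeff_pCons split: nat.splits)
  define y where "y = r1\<^sup>2 / of_int p"
  have r: "r1\<^sup>2 = of_int p * y" using assms(1) by (simp add: y_def)
  have "(r1 ^ 3 + of_int b * r1)\<^sup>2 = (of_int c)\<^sup>2" using root1 by simp
  also have "(r1 ^ 3 + of_int b * r1)\<^sup>2 = r1\<^sup>2 * (r1\<^sup>2 + of_int b)\<^sup>2"
    by (simp add: power2_eq_square power3_eq_cube algebra_simps)
  also have "\<dots> = of_int p ^ 3 * (y * (y + of_int \<epsilon>)\<^sup>2)"
  proof -
    have "P * y * (P * y + e * P)\<^sup>2 = P ^ 3 * (y * (y + e)\<^sup>2)" for P e :: complex
      by (simp add: power2_eq_square power3_eq_cube algebra_simps)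
    thus ?thesis by (simp only: r assms(2) of_int_mult)
  qed
  also have "(of_int c)\<^sup>2 = (of_int p ^ 3 * of_int (p * k\<^sup>2) :: complex)"
  proof -
    have "c\<^sup>2 = p ^ 3 * (p * k\<^sup>2)" by (simp add: assms(3) power2_eq_square power3_eq_cube)
    thus ?thesis by (simp only: of_int_power[symmetric] of_int_mult[symmetric])
  qed
  finally have y_eq: "y * (y + of_int \<epsilon>)\<^sup>2 = of_int (p * k\<^sup>2)" using assms(1) by simp
  have "poly [:- q, e\<^sup>2, 2 * e, 1:] y = y * (y + e)\<^sup>2 - q" for q e :: complex
    by (simp add: power2_eq_square algebra_simps)
  hence "poly ?f y = y * (y + of_int \<epsilon>)\<^sup>2 - of_int (p * k\<^sup>2)" .
  hence "poly ?f y = 0" by (simp only: y_eq diff_self)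
  thus "poly ?f (r1\<^sup>2 / of_int p) = 0" by (simp only: y_def)
qed

text \<open>The inertia group of \<open>P\<close> is trivial. Otherwise the three roots are congruent modulo \<open>P\<close>; their sum is
  0, so \<open>3 r1\<close> and \<open>b\<close> lie in \<open>P\<close>, and since \<open>p\<close> is not 3, so do \<open>r1\<close> and \<open>c\<close>. This leaves the case that
  \<open>p\<^sup>2\<close> divides \<open>c\<close>, where the three integers \<open>r\<^sup>2 / p\<close> would be congruent as well. Their product is
  divisible by \<open>p\<close>, so all of them would lie in \<open>P\<close>, whereas their second elementary symmetric function
  is 1.\<close>

lemma exists_moved_mod_prime:
  fixes p :: int
  assumes p: "Factorial_Ring.prime p" "p \<noteq> 3" "b = p \<or> b = - p"
    and c: "coprime c p \<or> p\<^sup>2 dvd c"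
    and P: "prime_in_order OL P"
  shows "\<exists>y\<in>OL. y - \<tau> y \<notin> P"
proof (rule ccontr)
  interpret P: prime_in_order OL P by (rule P)
  assume "\<not> (\<exists>y\<in>OL. y - \<tau> y \<notin> P)"
  hence triv: "y - \<tau> y \<in> P" if "y \<in> OL" for y using that by blast
  have rO: "r1 \<in> OL" "r2 \<in> OL" "r3 \<in> OL"
    using roots_in_L roots_algebraic_int by (auto simp: OL_def)
  have d: "r1 - r2 \<in> P" "r2 - r3 \<in> P"
    using triv[of r1] triv[of r2] rO by (simp_all add: \<tau>_roots)
  have p0: "p \<noteq> 0" using p(1) by auto
  have "3 * r1 = (r1 - r2) + (r1 - r2) + (r2 - r3)" unfolding r3_eq by simp
  also have "\<dots> \<in> P" using d by (intro P.P_add)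
  finally have r3P: "3 * r1 \<in> P" .
  have "of_int b = (2 * r1 + r2) * (r1 - r2) - r1 * (3 * r1)"
    unfolding b_eq by (simp add: power2_eq_square algebra_simps)
  also have "\<dots> \<in> P"
  proof (rule P.P_diff)
    have "of_int 2 * r1 + r2 \<in> OL" using rO by (intro P.A_add P.A_mult P.A_of_int)
    thus "(2 * r1 + r2) * (r1 - r2) \<in> P" using d by (intro P.P_mult) simp_all
    show "r1 * (3 * r1) \<in> P" by (rule P.P_mult[OF rO(1) r3P])
  qed
  finally have bP: "of_int b \<in> P" .
  have pP: "of_int p \<in> P" using p(3) bP P.P_minus[OF bP] by auto
  have "coprime 3 p" using p primes_coprime[of 3 p] by simp
  then obtain \<alpha> \<beta> where ab: "\<alpha> * 3 + \<beta> * p = 1" by (metis bezout_int coprime_imp_gcd_eq_1)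
  have "r1 = of_int (\<alpha> * 3 + \<beta> * p) * r1" by (simp add: ab)
  also have "\<dots> = of_int \<alpha> * (3 * r1) + (of_int \<beta> * r1) * of_int p" by (simp add: algebra_simps)
  also have "\<dots> \<in> P"
    by (rule P.P_add[OF P.P_mult[OF P.A_of_int r3P] P.P_mult[OF P.A_mult[OF P.A_of_int rO(1)] pP]])
  finally have r1P: "r1 \<in> P" .
  have "of_int c = - ((r1 * r1) * r1) - of_int b * r1" using root1 by (simp add: power3_eq_cube)
  also have "\<dots> \<in> P"
    using P.P_mult[OF P.A_mult[OF rO(1) rO(1)] r1P] P.P_mult[OF P.A_of_int r1P]
    by (intro P.P_diff P.P_minus)
  finally have cP: "of_int c \<in> P" .
  show False
    using c
  proof
    assume "coprime c p"
    then obtain u v where uv: "u * c + v * p = 1" by (metis bezout_int coprime_imp_gcd_eq_1)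
    have "of_int u * of_int c + of_int v * of_int p \<in> P"
      using cP pP by (intro P.P_add P.P_mult P.A_of_int)
    also have "of_int u * of_int c + of_int v * of_int p = (of_int (u * c + v * p) :: complex)" by simp
    finally show False using P.P_one uv by simp
  next
    assume "p\<^sup>2 dvd c"
    then obtain k where k: "c = p\<^sup>2 * k" by blast
    obtain \<epsilon> where \<epsilon>: "b = \<epsilon> * p" "\<epsilon> * \<epsilon> = 1" using p(3) that by (metis minus_mult_minus mult_1 mult_minus_left)
    interpret rot: cubic_roots b c r2 r3 r1 s by (rule rotate)
    interpret rot2: cubic_roots b c r3 r1 r2 s by (rule rot.rotate)
    define y1 y2 y3 where "y1 = r1\<^sup>2 / of_int p" and "y2 = r2\<^sup>2 / of_int p" and "y3 = r3\<^sup>2 / of_int p"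
    note F = subfield_CCD[OF subfield_L]
    have yO: "y1 \<in> OL" "y2 \<in> OL" "y3 \<in> OL"
      using root_sq_div_integral[OF p0 \<epsilon>(1) k] rot.root_sq_div_integral[OF p0 \<epsilon>(1) k]
        rot2.root_sq_div_integral[OF p0 \<epsilon>(1) k] roots_in_L
      by (auto simp: OL_def y1_def y2_def y3_def intro!: F)
    have inv_p: "inverse (of_int p) \<in> K" by (intro subfield_CCD[OF subfield_K])
    have sq: "\<tau> (r\<^sup>2 / of_int p) = (\<tau> r)\<^sup>2 / of_int p" if "r \<in> L" for r
      using that inv_p K_subset_L by (simp add: divide_inverse power2_eq_square \<tau>_mult \<tau>_K F subsetD)
    have \<tau>y: "\<tau> y1 = y2" "\<tau> y2 = y3"
      using roots_in_L by (simp_all add: y1_def y2_def y3_def sq \<tau>_roots)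
    have dy: "y1 - y2 \<in> P" "y2 - y3 \<in> P" using triv[of y1] triv[of y2] yO by (simp_all add: \<tau>y)
    have "y1 * y2 * y3 = (r1 * r2 * r3)\<^sup>2 / of_int p ^ 3"
      by (simp add: y1_def y2_def y3_def power2_eq_square power3_eq_cube)
    also have "\<dots> = of_int (k\<^sup>2) * of_int p"
    proof -
      have "(- (q\<^sup>2 * l))\<^sup>2 / q ^ 3 = l\<^sup>2 * q" if "q \<noteq> 0" for q l :: complex
        using that by (simp add: power2_eq_square power3_eq_cube)
      from this[of "of_int p" "of_int k"] p0 show ?thesis
        by (simp only: e3 k of_int_mult of_int_power of_int_eq_0_iff simp_thms)
    qed
    also have "\<dots> \<in> P" using pP by (intro P.P_mult P.A_of_int)
    finally have "y1 \<in> P \<or> y2 \<in> P \<or> y3 \<in> P"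
      using P.P_prime[of "y1 * y2" y3] P.P_prime[of y1 y2] yO P.A_mult by blast
    hence "y2 \<in> P"
      using P.P_add[OF dy(2), of y3] P.P_diff[OF _ dy(1), of y1] by auto
    hence yP: "y1 \<in> P" "y2 \<in> P"
      using P.P_add[OF dy(1), of y2] by auto
    have "y2 * y1 + y3 * y1 + y3 * y2 \<in> P" using yP yO by (intro P.P_add P.P_mult)
    also have "y2 * y1 + y3 * y1 + y3 * y2 = ((r1 * r2)\<^sup>2 + (r1 * r3)\<^sup>2 + (r2 * r3)\<^sup>2) / (of_int p)\<^sup>2"
      by (simp add: y1_def y2_def y3_def power2_eq_square add_divide_distrib mult_ac)
    also have "(r1 * r2)\<^sup>2 + (r1 * r3)\<^sup>2 + (r2 * r3)\<^sup>2 = (of_int b)\<^sup>2"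
      unfolding b_eq r3_eq by (simp add: power2_eq_square algebra_simps)
    also have "(of_int b)\<^sup>2 / (of_int p)\<^sup>2 = (of_int (\<epsilon> * \<epsilon>) :: complex)"
      using p0 by (simp add: \<epsilon>(1) power2_eq_square)
    finally show False using P.P_one \<epsilon>(2) by simp
  qed
qed

theorem unramified_at_finite_places_L:
  fixes p :: int
  assumes p: "Factorial_Ring.prime p" "p \<noteq> 3" "b = p \<or> b = - p"
    and c: "coprime c p \<or> p\<^sup>2 dvd c"
  shows "unramified_at_finite_places K L"
  unfolding unramified_at_finite_places_def
proof (intro allI impI)
  fix P assume P: "primeideal P (ring_of_integers L)" "P \<noteq> {0}"
  have prime: "prime_in_order OL P"
    unfolding OL_def by (rule prime_in_order_integers[OF subfield_L P(1)])
  interpret P: prime_in_order OL P by (rule prime)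
  have nz: "\<not> P \<subseteq> {0}" using P(2) P.P_zero by blast
  obtain y where y: "y \<in> OL" "y - \<tau> y \<notin> P"
    using exists_moved_mod_prime[OF p c prime] by blast
  have OL: "x \<in> L" if "x \<in> OL" for x using that by (simp add: OL_def)
  obtain z where z: "z \<in> P" "\<tau> z \<in> P" "\<tau> (\<tau> z) \<in> P" "z + \<tau> z + \<tau> (\<tau> z) \<notin> P.PP"
    using P.trace_not_in_square[of "{1, s, r1, s * r1, r1\<^sup>2, s * r1\<^sup>2}" \<tau> y] y nz L_finite_dim
      \<tau>_in_L \<tau>_mult \<tau>_order \<tau>_algebraic_int unfolding OL_def by blast
  have zL: "z \<in> L" using z(1) P.P_sub OL by blast
  have "z + \<tau> z + \<tau> (\<tau> z) \<in> P \<inter> K" using z zL by (auto intro: P.P_add trace_in_K)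
  moreover have "z + \<tau> z + \<tau> (\<tau> z) \<notin> ideal_prod (ring_of_integers L) P P"
    using z(4) unfolding P.PP_def by (simp add: ring_of_integers_def OL_def)
  ultimately show "ramification_index K L P = 1"
    using P(1) by (intro ramification_index_eq_1) (auto simp: primeideal_def)
qed

end

section \<open>Infinite places\<close>

context cubic_roots
begin

lemma cubic_factorization: "x ^ 3 + of_int b * x + of_int c = (x - r1) * (x - r2) * (x - r3)"
  unfolding b_eq c_eq r3_eq by (simp add: power2_eq_square power3_eq_cube algebra_simps)

lemma real_roots_if_one_real:
  assumes "s \<in> \<real>" "r1 \<in> \<real>"
  shows "r2 \<in> \<real>" "r3 \<in> \<real>"
proof -
  have "quad r1 (- 2 * (of_int b)\<^sup>2 / s, (9 * of_int c / s - 1) / 2, - 3 * of_int b / s) \<in> \<real>"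
    using assms unfolding quad_def prod.case
    by (intro Reals_add Reals_mult Reals_divide Reals_diff Reals_power Reals_minus) auto
  thus "r2 \<in> \<real>" by (simp only: r2_eq[symmetric])
  thus "r3 \<in> \<real>" unfolding r3_eq using assms(2) by (intro Reals_diff Reals_minus)
qed

text \<open>One root of the cubic is real, because complex conjugation permutes the roots; the others are
  polynomials in it with coefficients in the field of real numbers.\<close>

lemma roots_real:
  assumes s: "s \<in> \<real>"
  shows "r1 \<in> \<real> \<and> r2 \<in> \<real> \<and> r3 \<in> \<real>"
proof (cases "r1 \<in> \<real>")
  case True
  thus ?thesis using real_roots_if_one_real s by blast
next
  case False
  interpret rot: cubic_roots b c r2 r3 r1 s by (rule rotate)
  interpret rot2: cubic_roots b c r3 r1 r2 s by (rule rot.rotate)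
  have "cnj (r1 ^ 3 + of_int b * r1 + of_int c) = 0" using root1 by simp
  hence "(cnj r1) ^ 3 + of_int b * cnj r1 + of_int c = 0" by simp
  hence "cnj r1 = r1 \<or> cnj r1 = r2 \<or> cnj r1 = r3" unfolding cubic_factorization by auto
  hence "cnj r1 = r2 \<or> cnj r1 = r3" using False Reals_cnj_iff by blast
  moreover have "r1 + cnj r1 \<in> \<real>" by (simp add: complex_add_cnj)
  moreover have "r3 = - (r1 + r2)" "r2 = - (r1 + r3)" using r3_eq by auto
  ultimately have "r3 \<in> \<real> \<or> r2 \<in> \<real>" by (metis Reals_minus)
  hence "r1 \<in> \<real>"
    using rot.real_roots_if_one_real[OF s] rot2.real_roots_if_one_real[OF s] by blast
  thus ?thesis using False by blast
qed

text \<open>An embedding maps the roots to roots of the same cubic, with \<open>\<sigma> s\<close> as the square root of the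
  discriminant.\<close>

theorem unramified_at_infinite_places_L: "unramified_at_infinite_places K L"
  unfolding unramified_at_infinite_places_def
proof (intro ballI impI)
  fix \<sigma> assume \<sigma>: "\<sigma> \<in> Ring.ring_hom (CC\<lparr>carrier := L\<rparr>) CC" and real: "\<sigma> ` K \<subseteq> \<real>"
  note F = subfield_CCD[OF subfield_L]
  have add: "\<sigma> (x + y) = \<sigma> x + \<sigma> y" if "x \<in> L" "y \<in> L" for x y
    using ring_hom_add[OF \<sigma>, of x y] that by simp
  have mult: "\<sigma> (x * y) = \<sigma> x * \<sigma> y" if "x \<in> L" "y \<in> L" for x y
    using ring_hom_mult[OF \<sigma>, of x y] that by simp
  have one: "\<sigma> 1 = 1" using ring_hom_one[OF \<sigma>] by simp
  have zero: "\<sigma> 0 = 0" using add[of 0 0] F by simp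
  have minus: "\<sigma> (- x) = - \<sigma> x" if "x \<in> L" for x
    using add[of x "- x"] that F zero by (simp add: eq_neg_iff_add_eq_0 add.commute)
  have diff: "\<sigma> (x - y) = \<sigma> x - \<sigma> y" if "x \<in> L" "y \<in> L" for x y
    using add[of x "- y"] minus[of y] that F by simp
  have nat: "\<sigma> (of_nat n) = of_nat n \<and> of_nat n \<in> L" for n
    by (induction n) (auto simp: zero one add F)
  have int: "\<sigma> (of_int i) = of_int i" for i
    using nat by (cases i rule: int_cases2) (auto simp: minus)
  define q1 q2 q3 where "q1 = \<sigma> r1" and "q2 = \<sigma> r2" and "q3 = \<sigma> r3"
  have sL: "s \<in> L" using s_in_K K_subset_L by blast
  have "(\<sigma> s)\<^sup>2 = \<sigma> (s\<^sup>2)" by (simp add: power2_eq_square mult sL)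
  also have "s\<^sup>2 = of_int (- 4 * b ^ 3 - 27 * c\<^sup>2)" by (simp add: s_sq)
  also have "\<sigma> \<dots> = s\<^sup>2" by (simp only: int) (simp add: s_sq)
  finally have "\<sigma> s = s \<or> \<sigma> s = - s" by (simp add: power2_eq_iff)
  hence \<sigma>s: "\<sigma> s \<notin> \<rat>" using s_irrat Rats_minus_iff by metis
  interpret q: cubic_roots b c q1 q2 q3 "\<sigma> s"
  proof
    show "q1 + q2 + q3 = 0"
      using arg_cong[OF e1, of \<sigma>] roots_in_L by (simp add: q1_def q2_def q3_def add zero F)
    show "q1 * q2 + q1 * q3 + q2 * q3 = of_int b"
      using arg_cong[OF e2, of \<sigma>] roots_in_L by (simp add: q1_def q2_def q3_def add mult int F)
    show "q1 * q2 * q3 = - of_int c"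
      using arg_cong[OF e3, of \<sigma>] roots_in_L int[of "- c"] by (simp add: q1_def q2_def q3_def mult F)
    show "\<sigma> s = (q1 - q2) * (q1 - q3) * (q2 - q3)"
      using arg_cong[OF s_def, of \<sigma>] roots_in_L by (simp add: q1_def q2_def q3_def mult diff F)
  qed (use no_rat_root \<sigma>s in auto)
  have qr: "q1 \<in> \<real>" using q.roots_real real s_in_K by blast
  show "\<sigma> ` L \<subseteq> \<real>"
  proof
    fix w assume "w \<in> \<sigma> ` L"
    then obtain k0 k1 k2 where w: "w = \<sigma> (k0 + k1 * r1 + k2 * r1\<^sup>2)" and k: "k0 \<in> K" "k1 \<in> K" "k2 \<in> K"
      unfolding L_def by (auto simp: quad_def)
    have kL: "k0 \<in> L" "k1 \<in> L" "k2 \<in> L" using k K_subset_L by auto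
    have "w = \<sigma> k0 + \<sigma> k1 * q1 + \<sigma> k2 * (q1 * q1)"
      using kL roots_in_L by (simp add: w q1_def power2_eq_square add mult F)
    moreover have "\<sigma> k0 \<in> \<real>" "\<sigma> k1 \<in> \<real>" "\<sigma> k2 \<in> \<real>" using real k by auto
    ultimately show "w \<in> \<real>" using qr by simp
  qed
qed

section \<open>Degrees and generators of the two fields\<close>

lemma dimension_K: "ring.dimension CC 2 \<rat> K"
proof -
  let ?E1 = "CC.line_extension \<rat> s {0}"
  have E1: "?E1 = {y * s | y. y \<in> \<rat>}" by (auto simp: CC.line_extension_mem_iff)
  have dim1: "CC.dimension (Suc 0) \<rat> ?E1"
    using CC.Suc_dim[of s "{0}" 0 \<rat>] CC.zero_dim[of \<rat>] s_nz by simp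
  have "1 \<notin> ?E1"
    unfolding E1 using K_indep[of "- 1"] by auto
  hence "CC.dimension (Suc (Suc 0)) \<rat> (CC.line_extension \<rat> 1 ?E1)"
    using CC.Suc_dim[OF _ _ dim1] by simp
  moreover have "CC.line_extension \<rat> 1 ?E1 = K"
    unfolding E1 by (simp add: set_eq_iff CC.line_extension_mem_iff K_def) blast
  ultimately show ?thesis by (simp add: numeral_2_eq_2)
qed

lemma dimension_L: "ring.dimension CC 3 K L"
proof -
  note F = subfield_CCD[OF subfield_K]
  let ?E1 = "CC.line_extension K (r1\<^sup>2) {0}"
  let ?E2 = "CC.line_extension K r1 ?E1"
  have E1: "?E1 = {z * r1\<^sup>2 | z. z \<in> K}" by (auto simp: CC.line_extension_mem_iff)
  have E2: "?E2 = {y * r1 + z * r1\<^sup>2 | y z. y \<in> K \<and> z \<in> K}"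
    unfolding E1 by (simp add: set_eq_iff CC.line_extension_mem_iff) blast
  have nz: "x = 0 \<and> y = 0 \<and> z = 0" if "x \<in> K" "y \<in> K" "z \<in> K" "x + y * r1 + z * r1\<^sup>2 = 0" for x y z
    using quad_K_nz[of "(x, y, z)"] that by (auto simp: quad_def)
  have "r1\<^sup>2 \<noteq> 0" using nz[of 0 0 1] F by auto
  hence dim1: "CC.dimension (Suc 0) K ?E1"
    using CC.Suc_dim[of "r1\<^sup>2" "{0}" 0 K] CC.zero_dim[of K] by simp
  have "r1 \<notin> ?E1"
  proof
    assume "r1 \<in> ?E1"
    then obtain z where z: "r1 = z * r1\<^sup>2" "z \<in> K" unfolding E1 by blast
    have "0 + - 1 * r1 + z * r1\<^sup>2 = 0" by (simp flip: z(1))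
    thus False using nz[OF F(2) F(5)[OF F(1)] z(2)] by simp
  qed
  hence dim2: "CC.dimension (Suc (Suc 0)) K ?E2" using CC.Suc_dim[OF _ _ dim1] by simp
  have "1 \<notin> ?E2"
  proof
    assume "1 \<in> ?E2"
    then obtain y z where yz: "1 = y * r1 + z * r1\<^sup>2" "y \<in> K" "z \<in> K" unfolding E2 by blast
    have "- 1 + y * r1 + z * r1\<^sup>2 = 0" by (simp only: add.assoc yz(1)[symmetric]) simp
    thus False using nz[OF F(5)[OF F(1)] yz(2,3)] by simp
  qed
  hence "CC.dimension (Suc (Suc (Suc 0))) K (CC.line_extension K 1 ?E2)"
    using CC.Suc_dim[OF _ _ dim2] by simp
  moreover have "CC.line_extension K 1 ?E2 = L"
  proof (intro equalityI subsetI)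
    fix x assume "x \<in> CC.line_extension K 1 ?E2"
    then obtain k y z where "x = k + (y * r1 + z * r1\<^sup>2)" "k \<in> K" "y \<in> K" "z \<in> K"
      unfolding E2 by (auto simp: CC.line_extension_mem_iff)
    thus "x \<in> L" unfolding L_def by (intro image_eqI[of _ _ "(k, y, z)"]) (auto simp: quad_def)
  next
    fix x assume "x \<in> L"
    then obtain k y z where x: "x = k + y * r1 + z * r1\<^sup>2" "k \<in> K" "y \<in> K" "z \<in> K"
      unfolding L_def by (auto simp: quad_def)
    have w: "y * r1 + z * r1\<^sup>2 \<in> ?E2" unfolding E2 using x by blast
    have eq: "x = k \<otimes>\<^bsub>CC\<^esub> 1 \<oplus>\<^bsub>CC\<^esub> (y * r1 + z * r1\<^sup>2)" using x(1) by (simp add: add.assoc)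
    show "x \<in> CC.line_extension K 1 ?E2"
      unfolding CC.line_extension_mem_iff[of x] using eq w x(2) by blast
  qed
  ultimately show ?thesis by (simp add: numeral_3_eq_3)
qed

lemma quadratic_field_K: "quadratic_field K"
  unfolding quadratic_field_def using subfield_K dimension_K by blast

lemma number_field_K: "number_field K"
  unfolding number_field_def CC.finite_dimension_def using subfield_K dimension_K by blast

lemma number_field_L: "number_field L"
  unfolding number_field_def CC.finite_dimension_def

  by (intro conjI exI subfield_L) (rule CC.telescopic_base[OF subfield_Rats subfield_K dimension_K dimension_L])

lemma K_minimal:
  assumes "subfield E CC" "s \<in> E" shows "K \<subseteq> E"
proof
  note E = subfield_CCD[OF assms(1)]
  fix z assume "z \<in> K"
  then obtain x y where "z = x + y * s" "x \<in> \<rat>" "y \<in> \<rat>" by (auto simp: K_def)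
  thus "z \<in> E" using E(3)[OF _ E(4)[OF _ assms(2)], of x y] E(11) by blast
qed

lemma adjoin_sqrt_disc:
  assumes "t\<^sup>2 = s\<^sup>2" shows "adjoin_rat {t} = K"
  unfolding adjoin_rat_def
proof (rule field.generate_fieldI[OF field_CC, symmetric])
  have ts: "t = s \<or> t = - s" using assms by (simp add: power2_eq_iff)
  show "\<rat> \<union> {t} \<subseteq> K"
    using ts s_in_K subfield_CCD(5,11)[OF subfield_K] by auto
  fix E assume E: "subfield E CC" "\<rat> \<union> {t} \<subseteq> E"
  hence "s \<in> E" using ts subfield_CCD(5)[OF E(1), of t] by auto
  thus "K \<subseteq> E" using K_minimal E(1) by blast
qed (use subfield_K in auto)

lemma adjoin_roots: "adjoin_rat {r1, r2, r3} = L"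
  unfolding adjoin_rat_def
proof (rule field.generate_fieldI[OF field_CC, symmetric])
  show "\<rat> \<union> {r1, r2, r3} \<subseteq> L"
    using roots_in_L subfield_CCD(11)[OF subfield_L] by auto
  fix E assume E: "subfield E CC" "\<rat> \<union> {r1, r2, r3} \<subseteq> E"
  note F = subfield_CCD[OF E(1)]
  have "s \<in> E" unfolding s_def using E(2) by (intro F(4,6)) auto
  hence "K \<subseteq> E" using K_minimal E(1) by blast
  thus "L \<subseteq> E" using E(2) unfolding L_def by (auto simp: quad_def intro!: F(3,4,9))
qed (use subfield_L in auto)

end

section \<open>The splitting field of the cubic\<close>

lemma irreducible_no_rational_root:
  fixes f :: "rat poly"
  assumes f: "Factorial_Ring.irreducible f" "degree f > 1"
  shows "poly f t \<noteq> 0"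
proof
  assume "poly f t = 0"
  then obtain g where g: "f = [:- t, 1:] * g" by (auto simp: poly_eq_0_iff_dvd)
  hence "is_unit g" using f(1) Factorial_Ring.irreducibleD[OF f(1) g] by (auto simp: is_unit_poly_iff)
  hence "degree g = 0" by (auto simp: is_unit_poly_iff)
  hence "degree f \<le> 1" unfolding g using degree_mult_le[of "[:- t, 1:]" g] by simp
  thus False using f(2) by simp
qed

lemma cubic_roots_exist:
  fixes b c :: int
  obtains r1 r2 r3 :: complex where "r1 + r2 + r3 = 0" "r1 * r2 + r1 * r3 + r2 * r3 = of_int b"
    "r1 * r2 * r3 = - of_int c"
proof -
  have "\<not> constant (poly [:of_int c, of_int b, 0, 1 :: complex:])"
    by (simp add: constant_degree)
  then obtain r1 where r1: "poly [:of_int c, of_int b, 0, 1:] r1 = (0 :: complex)"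
    using fundamental_theorem_of_algebra by blast
  define d where "d = csqrt (- 3 * r1\<^sup>2 - 4 * of_int b)"
  have d: "d\<^sup>2 = - 3 * r1\<^sup>2 - 4 * of_int b" by (simp add: d_def)
  define r2 r3 where "r2 = (- r1 + d) / 2" and "r3 = (- r1 - d) / 2"
  have "r2 * r3 = (r1\<^sup>2 - d\<^sup>2) / 4" by (simp add: r2_def r3_def power2_eq_square field_simps)
  hence r23: "r2 * r3 = r1\<^sup>2 + of_int b" by (simp add: d field_simps)
  have sum: "r1 + r2 + r3 = 0" by (simp add: r2_def r3_def field_simps)
  have "r1 * r2 + r1 * r3 + r2 * r3 = r1 * (r2 + r3) + r2 * r3" by (simp add: algebra_simps)
  also have "r2 + r3 = - r1" using sum by (simp add: eq_neg_iff_add_eq_0 algebra_simps)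
  finally have "r1 * r2 + r1 * r3 + r2 * r3 = of_int b" by (simp add: r23 power2_eq_square)
  moreover have "r1 * r2 * r3 = r1 * (r1\<^sup>2 + of_int b)" by (simp add: r23[symmetric] mult.assoc)
  moreover have "\<dots> = - of_int c"
    using r1 by (simp add: power2_eq_square algebra_simps eq_neg_iff_add_eq_0)
  ultimately show ?thesis using that sum by metis
qed

theorem corollary83:
  fixes p :: nat and b c \<delta> :: int and f :: "rat poly"
  assumes "Factorial_Ring.prime p" and "p \<noteq> 3"
    and "b = int p \<or> b = - int p"
    and "f = [:of_int c, of_int b, 0, 1:]"
    and "Factorial_Ring.irreducible f"
    and "coprime c (int p) \<or> (int p)^2 dvd c"
    and "\<delta> = - 4 * b^3 - 27 * c^2"
  shows "quadratic_field (adjoin_rat {csqrt (of_int \<delta>)}) \<and>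
         unramified_extension (adjoin_rat {csqrt (of_int \<delta>)}) (splitting_field f)"
proof -
  have no_root: "poly f t \<noteq> 0" for t
    using irreducible_no_rational_root[OF assms(5)] by (simp add: assms(4))
  have no_rat_root: "t ^ 3 + of_int b * t + of_int c \<noteq> 0" if "t \<in> \<rat>" for t :: complex
  proof
    obtain u where u: "t = of_rat u" using \<open>t \<in> \<rat>\<close> by (auto simp: Rats_def)
    assume "t ^ 3 + of_int b * t + of_int c = 0"
    hence "(of_rat (u ^ 3 + of_int b * u + of_int c) :: complex) = 0"
      by (simp add: u of_rat_add of_rat_mult of_rat_power)
    hence "u ^ 3 + of_int b * u + of_int c = 0" by simp
    thus False using no_root[of u] by (simp add: assms(4) power3_eq_cube algebra_simps)
  qed
  have no_int_root: "t ^ 3 + b * t + c \<noteq> 0" for t :: int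
  proof
    assume "t ^ 3 + b * t + c = 0"
    hence "(of_int (t ^ 3 + b * t + c) :: complex) = 0" by simp
    thus False using no_rat_root[of "of_int t"] by simp
  qed
  have p: "Factorial_Ring.prime (int p)" "int p \<noteq> 3" using assms(1,2) by auto
  obtain r1 r2 r3 :: complex where r: "r1 + r2 + r3 = 0" "r1 * r2 + r1 * r3 + r2 * r3 = of_int b"
    "r1 * r2 * r3 = - of_int c" by (rule cubic_roots_exist)
  define s where "s = (r1 - r2) * (r1 - r3) * (r2 - r3)"
  have s_sq_\<delta>: "s\<^sup>2 = of_int \<delta>"
  proof -
    have 3: "r3 = - r1 - r2" using r(1) by (simp add: eq_neg_iff_add_eq_0 algebra_simps)
    have b: "of_int b = - r1\<^sup>2 - r1 * r2 - r2\<^sup>2"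
      unfolding r(2)[symmetric] 3 by (simp add: power2_eq_square algebra_simps)
    have c: "of_int c = r1 * r2 * (r1 + r2)" using r(3) unfolding 3 by (simp add: algebra_simps)
    have "of_int \<delta> = - 4 * of_int b ^ 3 - 27 * (of_int c :: complex)\<^sup>2" by (simp add: assms(7))
    also have "\<dots> = s\<^sup>2"
      unfolding s_def b c 3 by (simp add: power2_eq_square power3_eq_cube algebra_simps)
    finally show ?thesis by simp
  qed
  have "s \<notin> \<rat>"
  proof
    assume s: "s \<in> \<rat>"
    have "algebraic_int s"
    proof (rule algebraic_int.intros)
      show "lead_coeff [:- of_int \<delta>, 0, 1 :: complex:] = 1" by simp
      show "\<forall>i. coeff [:- of_int \<delta>, 0, 1 :: complex:] i \<in> \<int>"
        by (auto simp: coeff_pCons split: nat.splits)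
      show "poly [:- of_int \<delta>, 0, 1:] s = 0" using s_sq_\<delta> by (simp add: power2_eq_square)
    qed
    then obtain d where "s = of_int d" using rational_algebraic_int_is_int s by (auto elim: Ints_cases)
    hence "(of_int (d\<^sup>2) :: complex) = of_int \<delta>" using s_sq_\<delta> by simp
    hence "d\<^sup>2 = \<delta>" by (simp only: of_int_eq_iff)
    thus False using discriminant_not_square[OF p assms(3) no_int_root assms(6), of d] assms(7) by simp
  qed
  then interpret cubic_roots b c r1 r2 r3 s
    using r no_rat_root by unfold_locales (auto simp: s_def)
  have K: "adjoin_rat {csqrt (of_int \<delta>)} = K"
    by (rule adjoin_sqrt_disc) (simp add: s_sq_\<delta>)
  have "{z. poly (map_poly of_rat f) z = 0} = {r1, r2, r3}"
  proof -
    have "poly (map_poly of_rat f) z = (z - r1) * (z - r2) * (z - r3)" for z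
      unfolding cubic_factorization[symmetric]
      by (simp add: assms(4) map_poly_pCons power3_eq_cube algebra_simps)
    thus ?thesis by auto
  qed
  hence L: "splitting_field f = L" by (simp add: splitting_field_def adjoin_roots)
  show ?thesis
    unfolding K L unramified_extension_def
    using quadratic_field_K number_field_K number_field_L K_subset_L
      unramified_at_finite_places_L[OF p assms(3,6)] unramified_at_infinite_places_L by blast
qed

end
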